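(* Let $A \in \mathbb{C}^{n\times n}$ be Hermitian positive definite with smallest and largest eigenvalues $\lambda_{\min}$ and $\lambda_{\max}$, respectively, and let $\kappa(A) = \lambda_{\max}/\lambda_{\min}$. Let $\mathbf{b} \in \mathbb{C}^n$ with $\|\mathbf{b}\| = 1$, and let $f(z) = z\,g(z)$, where $g$ is a Stieltjes function. Let $M$ be the invariance index of the Krylov subspaces of $A$ and $\mathbf{b}$, and let $1 \le m \le M$. Then the $m$th Lanczos approximation $\mathbf{f}_m$ for $f(A)\mathbf{b}$ satisfies $$\|f(A)\mathbf{b}-\mathbf{f}_m\| \leq \left(1+\beta_{m+1}\frac{\lambda_{\max}}{\lambda_{\min}^2}\right) \min_{p \in \Pi_{m-1}}\|f(A)\mathbf{b}-p(A)\mathbf{b}\| \leq \left(1+\kappa(A)^2\right) \min_{p \in \Pi_{m-1}}\|f(A)\mathbf{b}-p(A)\mathbf{b}\|,$$ where $\beta_{m+1}$ is the coefficient produced in step $m$ of the Lanczos method applied to $A$ and $\mathbf{b}$.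
   Context: Exact arithmetic is assumed; $\|\cdot\|$ is the Euclidean norm; $(\cdot)^*$ is the conjugate transpose; $\Pi_{k}$ is the space of (complex) polynomials of degree at most $k$; $\mathbf{e}_i^{(k)}$ is the $i$th canonical unit vector of length $k$. Monotone is meant in the non-strict sense. Krylov subspaces: $\mathcal{K}_m(A,\mathbf{b}) = \operatorname{span}\{\mathbf{b},A\mathbf{b},\dots,A^{m-1}\mathbf{b}\} = \{p(A)\mathbf{b} : p \in \Pi_{m-1}\}$. The invariance index $M$ is the smallest $M$ such that $\mathcal{K}_{m+1}(A,\mathbf{b}) = \mathcal{K}_m(A,\mathbf{b})$ for all $m \ge M$. Lanczos method: set $\mathbf{v}_0 = \mathbf{0}$, $\mathbf{v}_1 = \mathbf{b}$, $\beta_1 = 0$. For $j = 1,2,\dots,M$: $\mathbf{w}_j = A\mathbf{v}_j - \beta_j \mathbf{v}_{j-1}$; $\alpha_j = \mathbf{v}_j^*\mathbf{w}_j$; replace $\mathbf{w}_j$ by $\mathbf{w}_j - \alpha_j\mathbf{v}_j$; $\beta_{j+1} = \|\mathbf{w}_j\|$; and, if $\beta_{j+1} \neq 0$, $\mathbf{v}_{j+1} = \mathbf{w}_j/\beta_{j+1}$. One has $\beta_{j+1} > 0$ for $j<M$ and $\beta_{M+1}=0$. The vectors $\mathbf{v}_1,\dots,\mathbf{v}_m$ form an orthonormal basis of $\mathcal{K}_m(A,\mathbf{b})$ for $m \le M$. Put $V_m = [\mathbf{v}_1 \mid \dots \mid \mathbf{v}_m] \in \mathbb{C}^{n\times m}$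 and let $T_m = V_m^*AV_m \in \mathbb{R}^{m\times m}$, which is the symmetric tridiagonal matrix with diagonal entries $\alpha_1,\dots,\alpha_m$ and off-diagonal entries $\beta_2,\dots,\beta_m$. The $m$th Lanczos approximation for $f(A)\mathbf{b}$ is $\mathbf{f}_m = V_m f(T_m)\mathbf{e}_1^{(m)}$. Stieltjes function: a function of the form $g(z) = \int_0^\infty \frac{1}{z+t}\,\mathrm{d}\mu(t)$ for $z \in (0,\infty)$, where $\mu:[0,\infty)\to\mathbb{R}$ is monotonically increasing and such that $\int_0^\infty \frac{1}{1+t}\,\mathrm{d}\mu(t) < \infty$ (an atom of the nonnegative measure $\mathrm{d}\mu$ at $t=0$ is allowed, so that e.g. $g(z)=1/z$ is a Stieltjes function). *)

theory Defs
  imports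
    "HOL-Analysis.Analysis"
    "Jordan_Normal_Form.Spectral_Radius"
begin

unbundle no vec_syntax
hide_const (open) Finite_Cartesian_Product.mat Finite_Cartesian_Product.vec

section \<open>Vectors, Hermitian matrices, polynomials and functions of matrices\<close>

definition vec_norm :: "complex vec \<Rightarrow> real" where
  "vec_norm v = L2_set (\<lambda>i. cmod (v $ i)) {..<dim_vec v}"

text \<open>Note that \<open>y \<bullet>c x\<close> conjugates its second argument, so it is $x^* y$.\<close>

definition hermitian_pos_def :: "complex mat \<Rightarrow> bool" where
  "hermitian_pos_def A \<longleftrightarrow> mat_adjoint A = A \<and>
     (\<forall>x \<in> carrier_vec (dim_row A). x \<noteq> 0\<^sub>v (dim_row A) \<longrightarrow> 0 < Re ((A *\<^sub>v x) \<bullet>c x))"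

definition lambda_min :: "complex mat \<Rightarrow> real" where
  "lambda_min A = Min {x. eigenvalue A (complex_of_real x)}"

definition lambda_max :: "complex mat \<Rightarrow> real" where
  "lambda_max A = Max {x. eigenvalue A (complex_of_real x)}"

definition cond_number :: "complex mat \<Rightarrow> real" where
  "cond_number A = lambda_max A / lambda_min A"

text \<open>The matrix $p(A)$ for a square matrix $A$.\<close>

definition mat_poly :: "complex poly \<Rightarrow> complex mat \<Rightarrow> complex mat" where
  "mat_poly p A = mat (dim_row A) (dim_row A)
     (\<lambda>(i, j). \<Sum>k\<le>degree p. coeff p k * (A ^\<^sub>m k) $$ (i, j))"

text \<open>
  The matrix function $f(A) = U f(D) U^*$ of a Hermitian matrix $A = U D U^*$ with $U$ unitary
  and $D$ real diagonal. Such a decomposition exists for every Hermitian matrix, and the value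
  does not depend on it by \<open>mat_fun_eqI\<close> below.
\<close>

definition unitary_diag :: "nat \<Rightarrow> complex mat \<Rightarrow> (nat \<Rightarrow> real) \<Rightarrow> complex mat \<Rightarrow> bool" where
  "unitary_diag n U d A \<longleftrightarrow> U \<in> carrier_mat n n \<and> mat_adjoint U * U = 1\<^sub>m n \<and>
     A = U * mat_diag n (\<lambda>i. complex_of_real (d i)) * mat_adjoint U"

definition mat_fun :: "(real \<Rightarrow> real) \<Rightarrow> complex mat \<Rightarrow> complex mat" where
  "mat_fun f A = (THE B. \<exists>U d. unitary_diag (dim_row A) U d A \<and>
     unitary_diag (dim_row A) U (f \<circ> d) B)"

lemma mat_adjoint_carrier: "U \<in> carrier_mat n m \<Longrightarrow> mat_adjoint U \<in> carrier_mat m n"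
  by (auto simp: mat_adjoint_def)

lemma unitary_diag_unique:
  assumes A1: "unitary_diag n U d A" and A2: "unitary_diag n V e A"
    and B: "unitary_diag n U (f \<circ> d) B" and C: "unitary_diag n V (f \<circ> e) C"
  shows "B = C"
proof -
  let ?D = "\<lambda>d. mat_diag n (\<lambda>i. complex_of_real (d i))"
  define U' where "U' = mat_adjoint U"
  define V' where "V' = mat_adjoint V"
  have U: "U \<in> carrier_mat n n" and V: "V \<in> carrier_mat n n"
    and U'U: "U' * U = 1\<^sub>m n" and V'V: "V' * V = 1\<^sub>m n"
    and AU: "A = U * ?D d * U'" and AV: "A = V * ?D e * V'"
    and BU: "B = U * ?D (f \<circ> d) * U'" and CV: "C = V * ?D (f \<circ> e) * V'"
    using assms unfolding unitary_diag_def U'_def V'_def by iprover+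
  have U': "U' \<in> carrier_mat n n" and V': "V' \<in> carrier_mat n n"
    using U V by (auto simp: U'_def V'_def mat_adjoint_carrier)
  have UU': "U * U' = 1\<^sub>m n" using mat_mult_left_right_inverse[OF U' U U'U] .
  have VV': "V * V' = 1\<^sub>m n" using mat_mult_left_right_inverse[OF V' V V'V] .
  define W where "W = U' * V"
  have W: "W \<in> carrier_mat n n" using U' V by (auto simp: W_def)
  have D [simp]: "?D h \<in> carrier_mat n n" for h by simp
  have left: "U' * (U * ?D h * U') * V = ?D h * W" for h
  proof -
    have "U' * (U * ?D h * U') * V = (U' * U) * ?D h * (U' * V)"
      using U V U' D[of h] by (simp add: assoc_mult_mat[of _ n n _ n _ n] mult_carrier_mat[of _ n n _ n])
    thus ?thesis using D[of h] by (simp add: U'U W_def left_mult_one_mat[OF D])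
  qed
  have right: "U' * (V * ?D h * V') * V = W * ?D h" for h
  proof -
    have "U' * (V * ?D h * V') * V = (U' * V) * ?D h * (V' * V)"
      using U V U' V' D[of h] by (simp add: assoc_mult_mat[of _ n n _ n _ n] mult_carrier_mat[of _ n n _ n])
    moreover have "(U' * V) * ?D h * 1\<^sub>m n = (U' * V) * ?D h"
      by (rule right_mult_one_mat, intro mult_carrier_mat, rule U', rule V, rule D)
    ultimately show ?thesis by (simp add: V'V W_def)
  qed
  have eq: "?D d * W = W * ?D e" using left[of d, folded AU] right[of e, folded AV] by (rule trans[OF sym])
  have entry: "(?D h * W) $$ (i, j) = complex_of_real (h i) * W $$ (i, j)"
    "(W * ?D h) $$ (i, j) = W $$ (i, j) * complex_of_real (h j)" if "i < n" "j < n" for h i j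
    using that W by (simp_all add: mat_diag_mult_left[OF W] mat_diag_mult_right[OF W])
  have "?D (f \<circ> d) * W = W * ?D (f \<circ> e)"
  proof (rule eq_matI)
    fix i j assume "i < dim_row (W * ?D (f \<circ> e))" "j < dim_col (W * ?D (f \<circ> e))"
    hence ij: "i < n" "j < n" using W by (auto simp: mat_diag_def)
    have "complex_of_real (d i) * W $$ (i, j) = W $$ (i, j) * complex_of_real (e j)"
      using entry(1)[OF ij, of d] entry(2)[OF ij, of e] unfolding eq by (rule trans[OF sym])
    hence "W $$ (i, j) = 0 \<or> d i = e j" by auto
    hence "complex_of_real ((f \<circ> d) i) * W $$ (i, j) = W $$ (i, j) * complex_of_real ((f \<circ> e) j)"
      by auto
    thus "(?D (f \<circ> d) * W) $$ (i, j) = (W * ?D (f \<circ> e)) $$ (i, j)"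
      unfolding entry[OF ij] .
  qed (use W in \<open>auto simp: mat_diag_def\<close>)
  hence main: "U' * B * V = U' * C * V"
    unfolding BU CV left right .
  have Bc: "B \<in> carrier_mat n n" and Cc: "C \<in> carrier_mat n n"
    unfolding BU CV using U V U' V' by (simp_all add: mult_carrier_mat[of _ n n _ n])
  have cancel: "U * (U' * X * V) * V' = X" if X: "X \<in> carrier_mat n n" for X
  proof -
    have "U * (U' * X * V) * V' = (U * U') * X * (V * V')"
      using U V U' V' X by (simp add: assoc_mult_mat[of _ n n _ n _ n] mult_carrier_mat[of _ n n _ n])
    thus ?thesis using X by (simp add: UU' VV')
  qed
  show ?thesis using cancel[OF Bc, unfolded main] cancel[OF Cc] by (rule trans[OF sym])
qed

lemma mat_fun_eqI:
  assumes "unitary_diag n U d A"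
  shows "mat_fun f A = U * mat_diag n (\<lambda>i. complex_of_real (f (d i))) * mat_adjoint U"
proof -
  let ?B = "U * mat_diag n (\<lambda>i. complex_of_real (f (d i))) * mat_adjoint U"
  have n: "dim_row A = n" using assms by (auto simp: unitary_diag_def)
  have B: "unitary_diag n U (f \<circ> d) ?B" using assms by (auto simp: unitary_diag_def)
  show ?thesis unfolding mat_fun_def n
  proof (rule the_equality)
    show "\<exists>U d. unitary_diag n U d A \<and> unitary_diag n U (f \<circ> d) ?B"
      using assms B by iprover
  next
    fix C assume "\<exists>U d. unitary_diag n U d A \<and> unitary_diag n U (f \<circ> d) C"
    then obtain V e where "unitary_diag n V e A" "unitary_diag n V (f \<circ> e) C" by iprover
    thus "C = ?B" using unitary_diag_unique[OF _ assms _ B] by iprover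
  qed
qed

section \<open>Krylov subspaces and the Lanczos method\<close>

definition krylov :: "complex mat \<Rightarrow> complex vec \<Rightarrow> nat \<Rightarrow> complex vec set" where
  "krylov A b m = LinearCombinations.module.span class_ring (module_vec TYPE(complex) (dim_vec b))
     {(A ^\<^sub>m k) *\<^sub>v b | k. k < m}"

definition invariance_index :: "complex mat \<Rightarrow> complex vec \<Rightarrow> nat" where
  "invariance_index A b = (LEAST M. \<forall>m\<ge>M. krylov A b (m + 1) = krylov A b m)"

text \<open>
  The vector \<open>lanczos_w A b j\<close> is $\mathbf{w}_j$ after subtraction of $\alpha_j \mathbf{v}_j$.
  If $\beta_{j+1} = 0$, the method stops after step $j$; the values of the functions at later
  indices have no meaning. The same holds for \<open>lanczos_beta\<close> and \<open>lanczos_w\<close> at index 0.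
\<close>

function (sequential)
  lanczos_v :: "complex mat \<Rightarrow> complex vec \<Rightarrow> nat \<Rightarrow> complex vec" and
  lanczos_w :: "complex mat \<Rightarrow> complex vec \<Rightarrow> nat \<Rightarrow> complex vec" and
  lanczos_beta :: "complex mat \<Rightarrow> complex vec \<Rightarrow> nat \<Rightarrow> real"
where
  "lanczos_v A b 0 = 0\<^sub>v (dim_vec b)"
| "lanczos_v A b (Suc 0) = b"
| "lanczos_v A b (Suc (Suc j)) =
     complex_of_real (1 / lanczos_beta A b (Suc (Suc j))) \<cdot>\<^sub>v lanczos_w A b (Suc j)"
| "lanczos_beta A b 0 = 0"
| "lanczos_beta A b (Suc 0) = 0"
| "lanczos_beta A b (Suc (Suc j)) = vec_norm (lanczos_w A b (Suc j))"
| "lanczos_w A b 0 = 0\<^sub>v (dim_vec b)"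
| "lanczos_w A b (Suc j) =
     (let w = A *\<^sub>v lanczos_v A b (Suc j)
                - complex_of_real (lanczos_beta A b (Suc j)) \<cdot>\<^sub>v lanczos_v A b j;
          \<alpha> = w \<bullet>c lanczos_v A b (Suc j)
      in w - \<alpha> \<cdot>\<^sub>v lanczos_v A b (Suc j))"
  by pat_completeness auto
termination
  by (relation "Wellfounded.measure (case_sum (\<lambda>(A, b, j). 3 * j + 1)
    (case_sum (\<lambda>(A, b, j). 3 * j + 2) (\<lambda>(A, b, j). 3 * j)))") auto

definition lanczos_V :: "complex mat \<Rightarrow> complex vec \<Rightarrow> nat \<Rightarrow> complex mat" where
  "lanczos_V A b m = mat_of_cols (dim_vec b) (map (lanczos_v A b) [1..<m + 1])"

definition lanczos_T :: "complex mat \<Rightarrow> complex vec \<Rightarrow> nat \<Rightarrow> complex mat" where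
  "lanczos_T A b m = mat_adjoint (lanczos_V A b m) * A * lanczos_V A b m"

text \<open>Vectors are indexed from 0, so $\mathbf{e}_1^{(m)}$ is \<open>unit_vec m 0\<close>.\<close>

definition lanczos_approx :: "(real \<Rightarrow> real) \<Rightarrow> complex mat \<Rightarrow> complex vec \<Rightarrow> nat \<Rightarrow> complex vec"
where
  "lanczos_approx f A b m =
     lanczos_V A b m *\<^sub>v (mat_fun f (lanczos_T A b m) *\<^sub>v unit_vec m 0)"

section \<open>Stieltjes functions\<close>

text \<open>
  The measure $\mathrm{d}\mu$ of an increasing function $\mu$ on $[0,\infty)$. The function
  \<open>interval_measure\<close> needs a right-continuous function on the whole real line, so $\mu$ is
  replaced by its right limits and extended by $\mu(0)$ to the left. The point 0 thus has
  mass $\mu(0+) - \mu(0)$.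
\<close>

definition stieltjes_measure :: "(real \<Rightarrow> real) \<Rightarrow> real measure" where
  "stieltjes_measure \<mu> =
     interval_measure (\<lambda>x. if x < 0 then \<mu> 0 else Lim (at_right x) \<mu>)"

definition stieltjes_function :: "(real \<Rightarrow> real) \<Rightarrow> bool" where
  "stieltjes_function g \<longleftrightarrow> (\<exists>\<mu>. mono_on {0..} \<mu> \<and>
     set_integrable (stieltjes_measure \<mu>) {0..} (\<lambda>t. 1 / (1 + t)) \<and>
     (\<forall>z>0. g z = (LINT t:{0..}|stieltjes_measure \<mu>. 1 / (z + t))))"

end

theory Submission
  imports Defs
begin

text \<open>
  Write \<open>v = v\<^sub>m\<^sub>+\<^sub>1\<close> and \<open>\<beta> = \<beta>\<^sub>m\<^sub>+\<^sub>1\<close>. In an orthonormal eigenbasis of \<open>A\<close> a vector is a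
  function \<open>i \<mapsto> x(i)\<close> and \<open>A\<close> multiplies it by the eigenvalue \<open>\<lambda>\<^sub>i\<close>. Diagonalise
  \<open>T\<^sub>m = W diag(\<theta>) W*\<close> and let \<open>y\<^sub>k\<close> be the Ritz vector, that is \<open>V\<^sub>m\<close> applied to the
  \<open>k\<close>-th column of \<open>W\<close>. The Ritz vectors are an orthonormal basis of the Krylov space, and the
  three-term recurrence says that \<open>(\<lambda>\<^sub>i - \<theta>\<^sub>k) y\<^sub>k(i) = \<beta> \<omega>\<^sub>k v(i)\<close>, where \<open>\<omega>\<^sub>k\<close> is the last
  entry of that column (\<open>y_residual\<close>).

  For \<open>f(z) = \<integral> z / (z + t) d\<mu>(t)\<close> the difference \<open>f(x) - f(z)\<close> is
  \<open>(x - z) \<integral> t / ((x + t) (z + t)) d\<mu>(t)\<close>. With \<open>b = \<Sum>\<^sub>k \<gamma>\<^sub>k y\<^sub>k\<close> the error \<open>e\<close> of the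
  Lanczos approximation is therefore
  \<open>e(i) = \<beta> v(i) \<integral> t / (\<lambda>\<^sub>i + t) (\<Sum>\<^sub>k \<omega>\<^sub>k \<gamma>\<^sub>k / (\<theta>\<^sub>k + t)) d\<mu>(t)\<close>.
  The sum over \<open>k\<close> is a corner entry of the inverse of \<open>T\<^sub>m + t\<close>. As \<open>T\<^sub>m\<close> is tridiagonal,
  this entry is \<open>C / \<Prod>\<^sub>k (\<theta>\<^sub>k + t)\<close> with \<open>C\<close> independent of \<open>t\<close>
  (\<open>partial_fractions_numerator_constant\<close>): apart from the factor \<open>C\<close> the integrand is
  nonnegative for every \<open>i\<close>, so nothing cancels (\<open>E_eq\<close>).

  The best approximation from the Krylov space has the error \<open>e - P e\<close>, where \<open>P\<close> is the
  orthogonal projection onto that space. Since \<open>v\<close> is orthogonal to the Krylov space and has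
  norm at most 1, the norm of \<open>e - P e\<close> is at least \<open>|\<langle>e, v\<rangle>|\<close>. The residual equation
  turns the coefficient \<open>\<langle>e, y\<^sub>k\<rangle>\<close> into the integral for \<open>\<langle>e, v\<rangle>\<close> with the additional factor
  \<open>- \<beta> \<omega>\<^sub>k / (\<theta>\<^sub>k + t)\<close> (up to conjugation), and \<open>\<theta>\<^sub>k\<close> is at least \<open>\<lambda>\<^sub>m\<^sub>i\<^sub>n\<close>. Because the integrand is
  nonnegative, \<open>|\<langle>e, y\<^sub>k\<rangle>| \<le> (\<beta> / \<lambda>\<^sub>m\<^sub>i\<^sub>n) |\<omega>\<^sub>k| |\<langle>e, v\<rangle>|\<close>, and as
  \<open>\<Sum>\<^sub>k |\<omega>\<^sub>k|\<^sup>2 = 1\<close>, the norm of \<open>P e\<close> is at most \<open>\<beta> / \<lambda>\<^sub>m\<^sub>i\<^sub>n\<close> times that of \<open>e - P e\<close>.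
  So \<open>e\<close> is at most \<open>1 + \<beta> / \<lambda>\<^sub>m\<^sub>i\<^sub>n\<close> times as long as the best error
  (\<open>error_le_projection_residual\<close>), and the constants of the theorem are not smaller, because
  \<open>\<lambda>\<^sub>m\<^sub>i\<^sub>n \<le> \<lambda>\<^sub>m\<^sub>a\<^sub>x\<close> and \<open>\<beta> \<le> \<lambda>\<^sub>m\<^sub>a\<^sub>x\<close>.

  That \<open>m\<close> does not exceed the invariance index gives \<open>\<beta>\<^sub>2, \<dots>, \<beta>\<^sub>m \<noteq> 0\<close>
  (\<open>lanczos_beta_nonzero\<close>). For \<open>\<beta>\<^sub>m\<^sub>+\<^sub>1 = 0\<close> the same formulas hold with \<open>v = 0\<close>.
\<close>

section \<open>Spectral theorem for Hermitian matrices\<close>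

lemma index_mat_adjoint:
  "i < dim_col A \<Longrightarrow> j < dim_row A \<Longrightarrow> mat_adjoint A $$ (i, j) = conjugate (A $$ (j, i))"
  by (simp add: mat_adjoint_def mat_of_rows_index)

lemma dim_mat_adjoint [simp]:
  "dim_row (mat_adjoint A) = dim_col A" "dim_col (mat_adjoint A) = dim_row A"
  by (simp_all add: mat_adjoint_def)

lemma adjoint_mult_index:
  fixes B C :: "complex mat"
  assumes "B \<in> carrier_mat n k" "C \<in> carrier_mat n l" "p < k" "q < l"
  shows "(mat_adjoint B * C) $$ (p, q) = (\<Sum>s<n. cnj (B $$ (s, p)) * C $$ (s, q))"
  using assms by (auto simp: scalar_prod_def index_mat_adjoint lessThan_atLeast0 intro!: sum.cong)

lemma mat_adjoint_mult:
  fixes A B :: "complex mat"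
  assumes "A \<in> carrier_mat n k" "B \<in> carrier_mat k l"
  shows "mat_adjoint (A * B) = mat_adjoint B * mat_adjoint A"
  using assms
  by (intro eq_matI)
    (auto simp: index_mat_adjoint scalar_prod_def intro!: sum.cong)

lemma mat_adjoint_adjoint: "mat_adjoint (mat_adjoint A) = (A :: complex mat)"
  by (intro eq_matI) (auto simp: index_mat_adjoint)

lemma mat_adjoint_four_block:
  fixes A B C D :: "complex mat"
  assumes "A \<in> carrier_mat a c" "B \<in> carrier_mat a d" "C \<in> carrier_mat b c" "D \<in> carrier_mat b d"
  shows "mat_adjoint (four_block_mat A B C D) =
    four_block_mat (mat_adjoint A) (mat_adjoint C) (mat_adjoint B) (mat_adjoint D)"
  using assms by (intro eq_matI) (auto simp: index_mat_adjoint)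

lemma mult_block_diag:
  fixes X X' Y Y' :: "complex mat"
    assumes "X \<in> carrier_mat 1 1" "X' \<in> carrier_mat 1 1" "Y \<in> carrier_mat n n" "Y' \<in> carrier_mat n n"
  shows "four_block_mat X (0\<^sub>m 1 n) (0\<^sub>m n 1) Y * four_block_mat X' (0\<^sub>m 1 n) (0\<^sub>m n 1) Y' =
    four_block_mat (X * X') (0\<^sub>m 1 n) (0\<^sub>m n 1) (Y * Y')"
proof -
  have "X * X' \<in> carrier_mat 1 1" "Y * Y' \<in> carrier_mat n n"
    using assms by auto
  thus ?thesis
    by (subst mult_four_block_mat[OF assms(1) zero_carrier_mat zero_carrier_mat assms(3) assms(2) zero_carrier_mat zero_carrier_mat assms(4)])
      (use assms in \<open>simp add: left_mult_zero_mat right_mult_zero_mat left_add_zero_mat right_add_zero_mat\<close>)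
qed

lemma cscalar_self_pos:
  fixes v :: "complex vec"
  assumes "v \<in> carrier_vec n" "v \<noteq> 0\<^sub>v n"
  shows "\<exists>r>0. v \<bullet>c v = complex_of_real r"
proof -
  have "0 \<le> v \<bullet>c v" "v \<bullet>c v \<noteq> 0"
    using assms by (auto simp: conjugate_square_eq_0_vec[of v n])
  thus ?thesis by (intro exI[of _ "Re (v \<bullet>c v)"])
      (auto simp: less_eq_complex_def complex_eq_iff)
qed

text \<open>
  The case \<open>c = 0\<close> is excluded by the unitarity of \<open>W\<close>, so the first column is a unit vector
  in the direction of \<open>v\<close>: complete \<open>v\<close> to a basis, orthogonalise, and normalise the columns.
\<close>

lemma unitary_completion:
  fixes v :: "complex vec"
  assumes v: "v \<in> carrier_vec n" "v \<noteq> 0\<^sub>v n"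
  shows "\<exists>W c. W \<in> carrier_mat n n \<and> mat_adjoint W * W = 1\<^sub>m n \<and> col W 0 = c \<cdot>\<^sub>v v"
proof -
  interpret cof_vec_space n "TYPE(complex)" .
  define bs where "bs = basis_completion v"
  define ws where "ws = gram_schmidt n bs"
  from basis_completion[OF v, folded bs_def]
  have bs: "distinct bs" "\<not> lin_dep (set bs)" "set bs \<subseteq> carrier_vec n" "hd bs = v" "length bs = n"
    by auto
  have ws: "set ws \<subseteq> carrier_vec n" "corthogonal ws" "length ws = n"
    using gram_schmidt_result[OF bs(3,1,2) refl, folded ws_def] bs(5) by auto
  have n: "0 < n" using v by (cases n) auto
  with bs(4,5) obtain bs' where "bs = v # bs'" by (cases bs) auto
  hence hd: "hd ws = v" unfolding ws_def using gram_schmidt_hd[OF v(1)] by simp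
  have hd0: "ws ! 0 = v" using hd ws(3) n by (cases ws) auto
  have wsi: "ws ! i \<in> carrier_vec n" if "i < n" for i using ws that by auto
  define r where "r i = (SOME r. 0 < r \<and> ws ! i \<bullet>c ws ! i = complex_of_real r)" for i
  have r: "0 < r i \<and> ws ! i \<bullet>c ws ! i = complex_of_real (r i)" if i: "i < n" for i
  proof -
    have "ws ! i \<bullet>c ws ! i \<noteq> 0" using corthogonalD[OF ws(2), of i i] i ws(3) by simp
    hence "ws ! i \<noteq> 0\<^sub>v n" by auto
    from cscalar_self_pos[OF wsi[OF i] this] show ?thesis unfolding r_def by (rule someI_ex[of "\<lambda>r. 0 < r \<and> _ r", simplified])
  qed
  define W where "W = mat n n (\<lambda>(i, j). ws ! j $ i / complex_of_real (sqrt (r j)))"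
  have W: "W \<in> carrier_mat n n" by (simp add: W_def)
  have "mat_adjoint W * W = 1\<^sub>m n"
  proof (rule eq_matI)
    fix i j assume "i < dim_row (1\<^sub>m n :: complex mat)" "j < dim_col (1\<^sub>m n :: complex mat)"
    hence ij: "i < n" "j < n" by auto
    have "(mat_adjoint W * W) $$ (i, j) = (\<Sum>k<n. cnj (W $$ (k, i)) * W $$ (k, j))"
      using ij W by (auto simp: scalar_prod_def index_mat_adjoint lessThan_atLeast0 intro!: sum.cong)
    also have "\<dots> = (\<Sum>k<n. ws ! j $ k * cnj (ws ! i $ k)) / (complex_of_real (sqrt (r i)) * complex_of_real (sqrt (r j)))"
      using ij by (simp add: W_def sum_divide_distrib mult_ac)
    also have "(\<Sum>k<n. ws ! j $ k * cnj (ws ! i $ k)) = ws ! j \<bullet>c ws ! i"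
      using wsi[OF ij(1)] wsi[OF ij(2)] by (auto simp: scalar_prod_def lessThan_atLeast0 intro!: sum.cong)
    also have "\<dots> / (complex_of_real (sqrt (r i)) * complex_of_real (sqrt (r j))) = (if i = j then 1 else 0)"
    proof (cases "i = j")
      case True
      have "complex_of_real (sqrt (r j)) * complex_of_real (sqrt (r j)) = complex_of_real (r j)"
        using r[OF ij(2)] by (simp flip: of_real_mult)
      thus ?thesis using r[OF ij(2)] True by simp
    next
      case False
      thus ?thesis using corthogonalD[OF ws(2), of j i] ij ws(3) by simp
    qed
    finally show "(mat_adjoint W * W) $$ (i, j) = 1\<^sub>m n $$ (i, j)" using ij by simp
  qed (use W in auto)
  moreover have "col W 0 = (1 / complex_of_real (sqrt (r 0))) \<cdot>\<^sub>v v"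
    using n v hd0 by (intro eq_vecI) (auto simp: W_def)
  ultimately show ?thesis using W by blast
qed

text \<open>
  Deflation. In an orthonormal basis that starts with an eigenvector, the first column of the
  matrix is a multiple of the first unit vector. By symmetry the same holds for the first row,
  and the induction hypothesis diagonalises the remaining block.
\<close>

theorem hermitian_unitary_diag:
  fixes A :: "complex mat"
  assumes "A \<in> carrier_mat n n" "mat_adjoint A = A"
  shows "\<exists>U d. unitary_diag n U d A"
  using assms
proof (induction n arbitrary: A)
  case 0
  show ?case
    by (rule exI[of _ "1\<^sub>m 0"]) (use 0 in \<open>auto simp: unitary_diag_def intro!: eq_matI\<close>)
next
  case (Suc n)
  let ?N = "Suc n"
  let ?D = "\<lambda>n d. mat_diag n (\<lambda>i. complex_of_real (d i))"
  note A = Suc.prems(1)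
  \<comment> \<open>The spectrum is nonempty, as the dimension is positive and the field is algebraically closed.\<close>
  obtain e v where ev: "eigenvector A v e"
    using spectrum_non_empty[OF A] unfolding spectrum_def eigenvalue_def by auto
  hence v: "v \<in> carrier_vec ?N" "v \<noteq> 0\<^sub>v ?N" and Av: "A *\<^sub>v v = e \<cdot>\<^sub>v v"
    using A by (auto simp: eigenvector_def)
  obtain W c where W: "W \<in> carrier_mat ?N ?N" and W'W: "mat_adjoint W * W = 1\<^sub>m ?N"
    and col: "col W 0 = c \<cdot>\<^sub>v v"
    using unitary_completion[OF v] by blast
  define W' where "W' = mat_adjoint W"
  have W': "W' \<in> carrier_mat ?N ?N" using W by (simp add: W'_def mat_adjoint_carrier)
  note W'W = W'W[folded W'_def]
  have WW': "W * W' = 1\<^sub>m ?N" using mat_mult_left_right_inverse[OF W' W W'W] .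
  define B where "B = W' * A * W"
  have B: "B \<in> carrier_mat ?N ?N" using W W' A by (simp add: B_def)
  have AB: "A = W * B * W'"
  proof -
    have "W * B * W' = (W * W') * A * (W * W')"
      using A W W' unfolding B_def by (simp add: assoc_mult_mat[of _ ?N ?N _ ?N _ ?N])
    thus ?thesis using A by (simp add: WW')
  qed
  have Badj: "mat_adjoint B = B"
  proof -
    have "mat_adjoint B = mat_adjoint W * (mat_adjoint A * mat_adjoint W')"
      unfolding B_def using A W W' by (simp add: mat_adjoint_mult[of _ ?N ?N _ ?N] mat_adjoint_carrier[of _ ?N ?N] assoc_mult_mat[of _ ?N ?N _ ?N _ ?N])
    also have "\<dots> = B" unfolding B_def W'_def Suc.prems(2) mat_adjoint_adjoint
      using A W W'[unfolded W'_def] by (simp add: assoc_mult_mat[of _ ?N ?N _ ?N _ ?N])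
    finally show ?thesis .
  qed
  have Bsym: "B $$ (i, j) = cnj (B $$ (j, i))" if "i < ?N" "j < ?N" for i j
    using index_mat_adjoint[of i B j] that B Badj by auto
  have B0: "B $$ (i, 0) = (if i = 0 then e else 0)" if i: "i < ?N" for i
  proof -
    have "A *\<^sub>v col W 0 = e \<cdot>\<^sub>v col W 0"
      unfolding col using A v by (simp add: Av mult_mat_vec smult_smult_assoc mult.commute)
    hence "col (A * W) 0 = e \<cdot>\<^sub>v col W 0" by (simp add: col_mult2[OF A W])
    hence "col (W' * (A * W)) 0 = W' *\<^sub>v (e \<cdot>\<^sub>v col W 0)"
      using A W W' by (simp add: col_mult2[of _ ?N ?N _ ?N])
    also have "\<dots> = e \<cdot>\<^sub>v (W' *\<^sub>v col W 0)" by (rule mult_mat_vec[OF W']) (rule col_carrier_vec[OF zero_less_Suc W])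
    also have "W' *\<^sub>v col W 0 = col (W' * W) 0" by (rule col_mult2[symmetric, OF W' W]) simp
    finally have "col B 0 = e \<cdot>\<^sub>v col (1\<^sub>m ?N) 0"
      unfolding B_def W'W using A W W' by (simp add: assoc_mult_mat[of _ ?N ?N _ ?N _ ?N])
    hence "col B 0 $ i = (e \<cdot>\<^sub>v col (1\<^sub>m ?N) 0) $ i" by simp
    thus ?thesis using i B by (auto split: if_splits)
  qed
  have e: "e = complex_of_real (Re e)"
    using Bsym[of 0 0] B0[of 0] by (simp add: complex_eq_iff)
  define C where "C = mat n n (\<lambda>(i, j). B $$ (Suc i, Suc j))"
  have C: "C \<in> carrier_mat n n" by (simp add: C_def)
  have "mat_adjoint C = C"
    by (intro eq_matI) (auto simp: index_mat_adjoint C_def Bsym[symmetric])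
  from Suc.IH[OF C this] obtain V d where V: "V \<in> carrier_mat n n" and V'V: "mat_adjoint V * V = 1\<^sub>m n"
    and CV: "C = V * ?D n d * mat_adjoint V"
    unfolding unitary_diag_def by blast
  note V' = mat_adjoint_carrier[OF V]
  let ?blk = "\<lambda>X Y. four_block_mat X (0\<^sub>m 1 n) (0\<^sub>m n 1) Y"
  define Z where "Z = ?blk (1\<^sub>m 1) V"
  define E where "E = (mat 1 1 (\<lambda>_. e) :: complex mat)"
  define d' where "d' = case_nat (Re e) d"
  have Z: "Z \<in> carrier_mat ?N ?N" using V by (auto simp: Z_def)
  have one': "mat_adjoint (1\<^sub>m 1 :: complex mat) = 1\<^sub>m 1"
    by (rule eq_matI) (auto simp: index_mat_adjoint)
  have Z': "mat_adjoint Z = ?blk (1\<^sub>m 1) (mat_adjoint V)"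
  proof -
    have z: "mat_adjoint (0\<^sub>m a c :: complex mat) = 0\<^sub>m c a" for a c
      by (rule eq_matI) (auto simp: index_mat_adjoint)
    show ?thesis
      unfolding Z_def mat_adjoint_four_block[OF one_carrier_mat zero_carrier_mat zero_carrier_mat V] one' z ..
  qed
  have Bblk: "B = ?blk E C"
  proof (rule eq_matI)
    fix i j assume "i < dim_row (?blk E C)" "j < dim_col (?blk E C)"
    hence ij: "i < ?N" "j < ?N" by (auto simp: E_def C_def)
    show "B $$ (i, j) = ?blk E C $$ (i, j)"
    proof (cases "j = 0")
      case True
      thus ?thesis using ij B0[OF ij(1)] by (simp add: E_def C_def)
    next
      case False
      hence "i = 0 \<Longrightarrow> B $$ (i, j) = 0" using B0[OF ij(2)] Bsym[OF ij] by simp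
      thus ?thesis using ij False by (auto simp: E_def C_def)
    qed
  qed (use B C in \<open>auto simp: E_def\<close>)
  have Dblk: "?D ?N d' = ?blk E (?D n d)"
  proof (rule eq_matI)
    fix i j assume "i < dim_row (?blk E (?D n d))" "j < dim_col (?blk E (?D n d))"
    hence ij: "i < ?N" "j < ?N" by (auto simp: E_def mat_diag_def)
    have d'0: "complex_of_real (d' 0) = e" using e by (simp add: d'_def)
    have d'S: "d' (Suc k) = d k" for k by (simp add: d'_def)
    show "?D ?N d' $$ (i, j) = ?blk E (?D n d) $$ (i, j)"
      using ij by (cases i; cases j) (simp_all add: mat_diag_def E_def d'0 d'S)
  qed (simp_all add: mat_diag_def E_def)
  have "unitary_diag ?N (W * Z) d' A" unfolding unitary_diag_def
  proof (intro conjI)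
    show "W * Z \<in> carrier_mat ?N ?N" using W Z by simp
    have adj: "mat_adjoint (W * Z) = mat_adjoint Z * W'"
      unfolding W'_def by (rule mat_adjoint_mult[OF W Z])
    note Zc' = mat_adjoint_carrier[OF Z]
    have ZZ: "mat_adjoint Z * Z = 1\<^sub>m ?N"
      unfolding Z' unfolding Z_def mult_block_diag[OF one_carrier_mat one_carrier_mat V' V] V'V
        left_mult_one_mat[OF one_carrier_mat] four_block_one_mat by (simp only: plus_1_eq_Suc)
    have "mat_adjoint (W * Z) * (W * Z) = mat_adjoint Z * (W' * W) * Z"
      unfolding adj using W Z W' Zc' by (simp add: assoc_mult_mat[of _ ?N ?N _ ?N _ ?N])
    thus "mat_adjoint (W * Z) * (W * Z) = 1\<^sub>m ?N" unfolding W'W right_mult_one_mat[OF Zc'] ZZ .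
    have D: "?D ?N d' \<in> carrier_mat ?N ?N" by simp
    have E: "E \<in> carrier_mat 1 1" by (simp add: E_def)
    have Dn: "?D n d \<in> carrier_mat n n" by simp
    have "Z * ?D ?N d' = ?blk E (V * ?D n d)"
      unfolding Z_def Dblk mult_block_diag[OF one_carrier_mat E V Dn] left_mult_one_mat[OF E] ..
    moreover have "?blk E (V * ?D n d) * mat_adjoint Z = B"
      unfolding Z' mult_block_diag[OF E one_carrier_mat mult_carrier_mat[OF V Dn] V']
        right_mult_one_mat[OF E] Bblk CV ..
    ultimately have "A = W * (Z * ?D ?N d' * mat_adjoint Z) * W'" using AB by simp
    also have "\<dots> = W * Z * ?D ?N d' * mat_adjoint (W * Z)"
      unfolding adj using W Z W' Zc' D
      by (simp add: assoc_mult_mat[of _ ?N ?N _ ?N _ ?N] mult_carrier_mat[of _ ?N ?N _ ?N])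
    finally show "A = W * Z * ?D ?N d' * mat_adjoint (W * Z)" .
  qed
  thus ?case by blast
qed

section \<open>The standard Hermitian form on coordinate functions\<close>

text \<open>
  Vectors are represented by their coordinate functions, of which only the values below \<open>n\<close>
  matter. In an eigenbasis of \<open>A\<close> every matrix function of \<open>A\<close> then acts by pointwise
  multiplication.
\<close>

definition ip :: "nat \<Rightarrow> (nat \<Rightarrow> complex) \<Rightarrow> (nat \<Rightarrow> complex) \<Rightarrow> complex" where
  "ip n x y = (\<Sum>i<n. x i * cnj (y i))"

definition nrm :: "nat \<Rightarrow> (nat \<Rightarrow> complex) \<Rightarrow> real" where
  "nrm n x = L2_set (\<lambda>i. cmod (x i)) {..<n}"

lemma ip_cong: "(\<And>i. i < n \<Longrightarrow> x i = x' i) \<Longrightarrow> (\<And>i. i < n \<Longrightarrow> y i = y' i) \<Longrightarrow> ip n x y = ip n x' y'"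
  by (simp add: ip_def)

lemma ip_add_left: "ip n (\<lambda>i. x i + y i) z = ip n x z + ip n y z"
  by (simp add: ip_def algebra_simps sum.distrib)

lemma ip_diff_left: "ip n (\<lambda>i. x i - y i) z = ip n x z - ip n y z"
  by (simp add: ip_def algebra_simps sum_subtractf)

lemma ip_scale_left: "ip n (\<lambda>i. c * x i) z = c * ip n x z"
  by (simp add: ip_def sum_distrib_left mult_ac)

lemma ip_sum_left: "ip n (\<lambda>i. \<Sum>k\<in>K. x k i) z = (\<Sum>k\<in>K. ip n (x k) z)"
  unfolding ip_def by (subst sum.swap) (simp add: sum_distrib_right)

lemma ip_commute: "ip n y x = cnj (ip n x y)"
  by (simp add: ip_def mult.commute)

lemma ip_add_right: "ip n z (\<lambda>i. x i + y i) = ip n z x + ip n z y"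
  by (simp add: ip_def algebra_simps sum.distrib)

lemma ip_scale_right: "ip n z (\<lambda>i. c * x i) = cnj c * ip n z x"
  by (simp add: ip_def sum_distrib_left mult_ac)

lemma ip_sum_right: "ip n z (\<lambda>i. \<Sum>k\<in>K. x k i) = (\<Sum>k\<in>K. ip n z (x k))"
  unfolding ip_def by (subst sum.swap) (simp add: sum_distrib_left)

lemmas ip_linear = ip_add_left ip_diff_left ip_scale_left ip_sum_left
  ip_add_right ip_scale_right ip_sum_right

lemma ip_mult_real: "ip n (\<lambda>i. complex_of_real (l i) * x i) y = ip n x (\<lambda>i. complex_of_real (l i) * y i)"
  by (simp add: ip_def mult_ac)

lemma nrm_nonneg [simp]: "0 \<le> nrm n x"
  by (simp add: nrm_def)

lemma ip_self: "ip n x x = complex_of_real ((nrm n x)\<^sup>2)"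
  by (simp add: ip_def nrm_def L2_set_def sum_nonneg complex_norm_square[symmetric])

lemma ip_le_nrm: "cmod (ip n x y) \<le> nrm n x * nrm n y"
proof -
  have "cmod (ip n x y) \<le> (\<Sum>i<n. \<bar>cmod (x i)\<bar> * \<bar>cmod (y i)\<bar>)"
    unfolding ip_def by (rule sum_norm_le) (simp add: norm_mult)
  also have "\<dots> \<le> nrm n x * nrm n y" unfolding nrm_def by (rule L2_set_mult_ineq)
  finally show ?thesis .
qed

lemma ip_self_eq_1_iff: "ip n x x = 1 \<longleftrightarrow> nrm n x = 1"
proof -
  have "ip n x x = 1 \<longleftrightarrow> (nrm n x)\<^sup>2 = 1\<^sup>2" unfolding ip_self by (metis of_real_eq_1_iff one_power2)
  also have "\<dots> \<longleftrightarrow> nrm n x = 1" by (subst power2_eq_iff_nonneg) simp_all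
  finally show ?thesis .
qed

lemma nrm_orth_add:
  assumes "ip n x y = 0"
  shows "(nrm n (\<lambda>i. x i + y i))\<^sup>2 = (nrm n x)\<^sup>2 + (nrm n y)\<^sup>2"
proof -
  have "complex_of_real ((nrm n (\<lambda>i. x i + y i))\<^sup>2) = complex_of_real ((nrm n x)\<^sup>2 + (nrm n y)\<^sup>2)"
    using assms ip_commute[of n y x]
    by (simp only: of_real_add ip_self[symmetric] ip_add_left ip_add_right) simp
  thus ?thesis by (simp only: of_real_eq_iff)
qed

section \<open>The Lanczos recurrence in eigenvector coordinates\<close>

text \<open>
  The Lanczos process for the diagonal operator with entries \<open>l\<close>, as a sequence \<open>v\<close> of
  coordinate functions. The vector after a breakdown is 0, so that the recurrence holds for every
  step; only the steps before step \<open>m\<close> are required not to break down.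
\<close>

locale lanczos_recurrence =
  fixes n m :: nat and l :: "nat \<Rightarrow> real" and v :: "nat \<Rightarrow> nat \<Rightarrow> complex"
    and \<alpha> :: "nat \<Rightarrow> complex" and \<beta> :: "nat \<Rightarrow> real"
  assumes m: "1 \<le> m"
    and v_0: "i < n \<Longrightarrow> v 0 i = 0"
    and v_1: "ip n (v 1) (v 1) = 1"
    and recurrence: "1 \<le> j \<Longrightarrow> i < n \<Longrightarrow>
      l i * v j i = \<beta> (Suc j) * v (Suc j) i + \<alpha> j * v j i + \<beta> j * v (j - 1) i"
    and alpha: "1 \<le> j \<Longrightarrow> \<alpha> j = ip n (\<lambda>i. l i * v j i - \<beta> j * v (j - 1) i) (v j)"
    and v_unit: "1 \<le> j \<Longrightarrow> \<beta> (Suc j) \<noteq> 0 \<Longrightarrow> ip n (v (Suc j)) (v (Suc j)) = 1"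
    and v_zero: "1 \<le> j \<Longrightarrow> \<beta> (Suc j) = 0 \<Longrightarrow> i < n \<Longrightarrow> v (Suc j) i = 0"
    and beta_nonzero: "1 \<le> j \<Longrightarrow> j < m \<Longrightarrow> \<beta> (Suc j) \<noteq> 0"
begin

abbreviation T :: "nat \<Rightarrow> nat \<Rightarrow> complex" where
  "T p q \<equiv> ip n (\<lambda>i. l i * v (Suc q) i) (v (Suc p))"

lemma ip_v_0: "ip n (v 0) x = 0" "ip n x (v 0) = 0"
  by (simp_all add: ip_def v_0)

lemma ip_v_self: "1 \<le> j \<Longrightarrow> j \<le> m \<Longrightarrow> ip n (v j) (v j) = 1"
  using v_1 v_unit[of "j - 1"] beta_nonzero[of "j - 1"] by (cases "j = 1") auto

lemma ip_recurrence_left: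
  "1 \<le> j \<Longrightarrow> ip n (\<lambda>i. l i * v j i) x =
     \<beta> (Suc j) * ip n (v (Suc j)) x + \<alpha> j * ip n (v j) x + \<beta> j * ip n (v (j - 1)) x"
  by (subst ip_cong[OF recurrence refl], simp_all add: ip_linear)

lemma ip_recurrence_right:
  "1 \<le> j \<Longrightarrow> ip n x (\<lambda>i. l i * v j i) =
     \<beta> (Suc j) * ip n x (v (Suc j)) + cnj (\<alpha> j) * ip n x (v j) + \<beta> j * ip n x (v (j - 1))"
  by (subst ip_cong[OF refl recurrence], simp_all add: ip_linear)

text \<open>
  The operator is self-adjoint, so the product of \<open>A v\<^sub>j\<close> with \<open>v\<^sub>k\<close> can be expanded by the
  recurrence at \<open>k\<close>. This gives \<open>\<beta>\<^sub>j\<close> for \<open>k = j - 1\<close> and 0 for smaller \<open>k\<close>, which is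
  exactly what the recurrence at \<open>j\<close> subtracts.
\<close>

lemma v_Suc_orthogonal:
  assumes "1 \<le> j" "j \<le> m" "k \<le> j"
  shows "ip n (v (Suc j)) (v k) = 0"
  using assms
proof (induction j arbitrary: k rule: less_induct)
  case (less j)
  note j = less.prems(1,2)
  show ?case
  proof (cases "k = 0 \<or> \<beta> (Suc j) = 0")
    case True
    thus ?thesis using v_zero[OF j(1)] ip_v_0(2) by (cases "k = 0") (simp_all add: ip_def)
  next
    case False
    hence k: "1 \<le> k" and b: "\<beta> (Suc j) \<noteq> 0" by auto
    have orth: "ip n (v a) (v c) = 0" if "c < a" "a \<le> j" for a c
    proof (cases "a = 1")
      case True
      thus ?thesis using that by (simp add: ip_v_0)
    next
      case False
      thus ?thesis using less.IH[of "a - 1" c] that j by auto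
    qed
    have orth': "ip n (v c) (v a) = 0" if "c < a" "a \<le> j" for a c
      using orth[OF that] ip_commute[of n "v c" "v a"] by simp
    have rec: "ip n (\<lambda>i. l i * v j i) (v k) =
        \<beta> (Suc j) * ip n (v (Suc j)) (v k) + \<alpha> j * ip n (v j) (v k) + \<beta> j * ip n (v (j - 1)) (v k)"
      by (rule ip_recurrence_left[OF j(1)])
    have "\<beta> (Suc j) * ip n (v (Suc j)) (v k) = 0"
    proof (cases "k = j")
      case True
      have "\<alpha> j = ip n (\<lambda>i. l i * v j i) (v j)"
        using alpha[OF j(1)] orth'[of "j - 1" j] j by (simp add: ip_linear)
      thus ?thesis using rec True orth'[of "j - 1" j] j ip_v_self[OF j] by simp
    next
      case False
      hence kj: "k < j" using less.prems(3) by simp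
      have "ip n (\<lambda>i. l i * v j i) (v k) = ip n (v j) (\<lambda>i. l i * v k i)"
        by (rule ip_mult_real)
      also have "\<dots> = \<beta> (Suc k) * ip n (v j) (v (Suc k))"
        using kj orth[of k j] orth[of "k - 1" j] by (simp add: ip_recurrence_right[OF k])
      finally have *: "ip n (\<lambda>i. l i * v j i) (v k) = \<beta> (Suc k) * ip n (v j) (v (Suc k))" .
      show ?thesis
      proof (cases "Suc k = j")
        case True
        thus ?thesis using rec * orth[OF kj] ip_v_self[OF j] ip_v_self[OF k] j by auto
      next
        case False
        thus ?thesis using rec * kj orth[of "Suc k" j] orth[of k j] orth[of k "j - 1"] by simp
      qed
    qed
    thus ?thesis using b by simp
  qed
qed

lemma ip_v:
  assumes "a \<le> Suc m" "1 \<le> c" "c \<le> m"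
  shows "ip n (v a) (v c) = (if a = c then 1 else 0)"
proof -
  consider "a = c" | "c < a" | "a < c" by linarith
  thus ?thesis
  proof cases
    case 1
    thus ?thesis using assms ip_v_self by simp
  next
    case 2
    thus ?thesis using v_Suc_orthogonal[of "a - 1" c] assms by simp
  next
    case 3
    have "ip n (v c) (v a) = 0"
    proof (cases "c = 1")
      case True
      thus ?thesis using 3 by (simp add: ip_v_0)
    next
      case False
      thus ?thesis using v_Suc_orthogonal[of "c - 1" a] assms 3 by auto
    qed
    thus ?thesis using 3 ip_commute[of n "v a" "v c"] by simp
  qed
qed

lemma T_eq:
  assumes "p < m" "q < m"
  shows "T p q = (if p = Suc q then of_real (\<beta> (Suc (Suc q))) else 0) +
    (if p = q then \<alpha> (Suc q) else 0) + (if Suc p = q then of_real (\<beta> (Suc q)) else 0)"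
  using assms by (subst ip_recurrence_left) (auto simp: ip_v)

text \<open>
  This is the relation \<open>A V\<^sub>m = V\<^sub>m T\<^sub>m + \<beta>\<^sub>m\<^sub>+\<^sub>1 v\<^sub>m\<^sub>+\<^sub>1 e\<^sub>m*\<close>, column by column.
\<close>

lemma T_expansion:
  assumes q: "q < m" and i: "i < n"
  shows "l i * v (Suc q) i = (\<Sum>p<m. T p q * v (Suc p) i) +
    (if Suc q = m then \<beta> (Suc m) * v (Suc m) i else 0)"
proof -
  have "(\<Sum>p<m. T p q * v (Suc p) i) =
    (\<Sum>p<m. (if p = Suc q then of_real (\<beta> (Suc (Suc q))) * v (Suc p) i else 0)) +
    (\<Sum>p<m. (if p = q then \<alpha> (Suc q) * v (Suc p) i else 0)) +
    (\<Sum>p<m. (if Suc p = q then of_real (\<beta> (Suc q)) * v (Suc p) i else 0))"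
    unfolding sum.distrib[symmetric] using q by (intro sum.cong refl) (auto simp: T_eq)
  also have "(\<Sum>p<m. (if Suc p = q then of_real (\<beta> (Suc q)) * v (Suc p) i else 0)) = \<beta> (Suc q) * v q i"
  proof (cases q)
    case 0
    thus ?thesis using i by (simp add: v_0)
  next
    case (Suc q')
    thus ?thesis using q by (simp add: sum.delta)
  qed
  finally show ?thesis using q recurrence[of "Suc q" i] i by (auto simp: sum.delta)
qed

text \<open>
  The degree is needed exactly: a breakdown then produces a nonzero polynomial of known degree
  that annihilates the starting vector.
\<close>

lemma lanczos_poly_step:
  assumes j: "1 \<le> j"
    and p: "degree p = j - 1" "p \<noteq> 0" "\<And>i. i < n \<Longrightarrow> v j i = poly p (complex_of_real (l i)) * v 1 i"
    and q: "q = 0 \<or> degree q < j" "\<And>i. i < n \<Longrightarrow> v (j - 1) i = poly q (complex_of_real (l i)) * v 1 i"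
  shows "\<exists>r. degree r = j \<and> (\<forall>i<n. \<beta> (Suc j) * v (Suc j) i = poly r (complex_of_real (l i)) * v 1 i)"
proof (intro exI conjI allI impI)
  let ?a = "[:- \<alpha> j, 1:] * p" and ?b = "Polynomial.smult (- complex_of_real (\<beta> j)) q"
  have a: "degree ?a = j" using p(1,2) j by (subst degree_mult_eq) auto
  have "degree ?b < j" using q(1) j by (auto intro: le_less_trans[OF degree_smult_le])
  thus "degree (?a + ?b) = j" using a by (simp only: degree_add_eq_left)
  show "\<beta> (Suc j) * v (Suc j) i = poly (?a + ?b) (complex_of_real (l i)) * v 1 i" if i: "i < n" for i
    using recurrence[OF j i] p(3)[OF i] q(2)[OF i] by (simp add: algebra_simps)
qed

lemma lanczos_poly_aux:
  "j \<le> m \<Longrightarrow> \<exists>p. (if j = 0 then p = 0 else p \<noteq> 0 \<and> degree p = j - 1) \<and>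
     (\<forall>i<n. v j i = poly p (complex_of_real (l i)) * v 1 i)"
proof (induction j rule: less_induct)
  case (less j)
  consider "j = 0" | "j = 1" | k where "j = Suc k" "1 \<le> k" by (metis One_nat_def Suc_leI not0_implies_Suc not_gr0)
  thus ?case
  proof cases
    case 1
    thus ?thesis using v_0 by (intro exI[of _ 0]) simp
  next
    case 2
    thus ?thesis by (intro exI[of _ 1]) simp
  next
    case 3
    have "k < j" "k - 1 < j" using 3 by auto
    obtain p where p: "p \<noteq> 0" "degree p = k - 1" "\<And>i. i < n \<Longrightarrow> v k i = poly p (complex_of_real (l i)) * v 1 i"
      using less.IH[of k] less.prems 3 by auto
    have "k - 1 \<le> m" using less.prems 3 by simp
    from less.IH[OF \<open>k - 1 < j\<close> this] obtain q where
      "if k - 1 = 0 then q = 0 else q \<noteq> 0 \<and> degree q = k - 1 - 1"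
      and q: "\<And>i. i < n \<Longrightarrow> v (k - 1) i = poly q (complex_of_real (l i)) * v 1 i"
      by blast
    hence "q = 0 \<or> degree q < k" using 3(2) by (auto split: if_splits)
    from lanczos_poly_step[OF 3(2) p(2,1,3) this q] obtain r where
      r: "degree r = k" "\<And>i. i < n \<Longrightarrow> \<beta> (Suc k) * v (Suc k) i = poly r (complex_of_real (l i)) * v 1 i"
      by auto
    have b: "\<beta> (Suc k) \<noteq> 0" using beta_nonzero[of k] 3 less.prems by simp
    let ?s = "Polynomial.smult (1 / complex_of_real (\<beta> (Suc k))) r"
    have "v j i = poly ?s (complex_of_real (l i)) * v 1 i" if "i < n" for i
      using r(2)[OF that] b 3(1) by (simp add: field_simps)
    moreover have "?s \<noteq> 0" "degree ?s = j - 1" using r(1) b 3 by auto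
    ultimately show ?thesis using 3(1) by (intro exI[of _ ?s]) simp
  qed
qed

lemma lanczos_poly:
  assumes "1 \<le> j" "j \<le> m"
  obtains p where "p \<noteq> 0" "degree p = j - 1" "\<And>i. i < n \<Longrightarrow> v j i = poly p (complex_of_real (l i)) * v 1 i"
  using lanczos_poly_aux[OF assms(2)] assms(1) by auto

lemma lanczos_residual_poly:
  obtains p where "degree p = m" "\<And>i. i < n \<Longrightarrow> \<beta> (Suc m) * v (Suc m) i = poly p (complex_of_real (l i)) * v 1 i"
proof -
  obtain p where p: "p \<noteq> 0" "degree p = m - 1" "\<And>i. i < n \<Longrightarrow> v m i = poly p (complex_of_real (l i)) * v 1 i"
    by (rule lanczos_poly[OF m order_refl]) blast
  from lanczos_poly_aux[OF diff_le_self] obtain q where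
    "if m - 1 = 0 then q = 0 else q \<noteq> 0 \<and> degree q = m - 1 - 1"
    and q: "\<And>i. i < n \<Longrightarrow> v (m - 1) i = poly q (complex_of_real (l i)) * v 1 i"
    by blast
  hence "q = 0 \<or> degree q < m" using m by (auto split: if_splits)
  from lanczos_poly_step[OF m p(2,1,3) this q] obtain r where "degree r = m"
    "\<forall>i<n. \<beta> (Suc m) * v (Suc m) i = poly r (complex_of_real (l i)) * v 1 i" by blast
  thus ?thesis by (intro that[of r]) simp_all
qed

text \<open>
  A power of \<open>A\<close> applied to \<open>v\<^sub>j\<close> stays in the span of the first \<open>j + k\<close> Lanczos vectors. The
  formulation by orthogonality avoids naming the coefficients.
\<close>

lemma orthogonal_power:
  assumes x: "\<And>j. 1 \<le> j \<Longrightarrow> j \<le> m \<Longrightarrow> ip n x (v j) = 0"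
  shows "j + k \<le> m \<Longrightarrow> ip n x (\<lambda>i. complex_of_real (l i) ^ k * v j i) = 0"
proof (induction k arbitrary: j)
  case 0
  thus ?case using x[of j] by (cases "j = 0") (auto simp: ip_v_0)
next
  case (Suc k)
  show ?case
  proof (cases "j = 0")
    case True
    thus ?thesis by (simp add: ip_def v_0)
  next
    case False
    hence j: "1 \<le> j" by simp
    have "ip n x (\<lambda>i. complex_of_real (l i) ^ Suc k * v j i) =
      ip n x (\<lambda>i. \<beta> (Suc j) * (complex_of_real (l i) ^ k * v (Suc j) i) +
        \<alpha> j * (complex_of_real (l i) ^ k * v j i) + \<beta> j * (complex_of_real (l i) ^ k * v (j - 1) i))"
    proof (intro ip_cong refl)
      fix i assume i: "i < n"
      have "complex_of_real (l i) ^ Suc k * v j i = complex_of_real (l i) ^ k * (l i * v j i)" by simp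
      thus "complex_of_real (l i) ^ Suc k * v j i = \<beta> (Suc j) * (complex_of_real (l i) ^ k * v (Suc j) i) +
        \<alpha> j * (complex_of_real (l i) ^ k * v j i) + \<beta> j * (complex_of_real (l i) ^ k * v (j - 1) i)"
        unfolding recurrence[OF j i] by (simp add: algebra_simps)
    qed
    also have "\<dots> = 0"
      unfolding ip_add_right ip_scale_right using Suc.IH[of "Suc j"] Suc.IH[of j] Suc.IH[of "j - 1"] Suc.prems by simp
    finally show ?thesis .
  qed
qed

lemma orthogonal_poly:
  assumes x: "\<And>j. 1 \<le> j \<Longrightarrow> j \<le> m \<Longrightarrow> ip n x (v j) = 0" and p: "degree p \<le> m - 1"
  shows "ip n x (\<lambda>i. poly p (complex_of_real (l i)) * v 1 i) = 0"
proof -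
  have "ip n x (\<lambda>i. poly p (complex_of_real (l i)) * v 1 i) =
    ip n x (\<lambda>i. \<Sum>k\<le>degree p. coeff p k * (complex_of_real (l i) ^ k * v 1 i))"
    by (simp add: poly_altdef sum_distrib_right mult.assoc)
  also have "\<dots> = 0"
    unfolding ip_sum_right ip_scale_right using p m orthogonal_power[OF x, of 1] by simp
  finally show ?thesis .
qed

text \<open>
  If there is no breakdown, \<open>\<beta>\<^sub>m\<^sub>+\<^sub>1\<close> is the product of \<open>A v\<^sub>m\<close> with the unit vector \<open>v\<^sub>m\<^sub>+\<^sub>1\<close>.
\<close>

lemma beta_le:
  assumes C: "0 \<le> C" "\<And>i. i < n \<Longrightarrow> \<bar>l i\<bar> \<le> C"
  shows "\<bar>\<beta> (Suc m)\<bar> \<le> C"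
proof (cases "\<beta> (Suc m) = 0")
  case False
  have "ip n (v m) (v (Suc m)) = 0" "ip n (v (m - 1)) (v (Suc m)) = 0"
    using v_Suc_orthogonal[OF m order_refl, of m] v_Suc_orthogonal[OF m order_refl, of "m - 1"]
      ip_commute[of n "v m" "v (Suc m)"] ip_commute[of n "v (m - 1)" "v (Suc m)"] by simp_all
  hence "ip n (\<lambda>i. l i * v m i) (v (Suc m)) = \<beta> (Suc m)"
    using ip_recurrence_left[OF m, of "v (Suc m)"] v_unit[OF m False] by simp
  hence "\<bar>\<beta> (Suc m)\<bar> \<le> nrm n (\<lambda>i. l i * v m i) * nrm n (v (Suc m))"
    using ip_le_nrm[of n "\<lambda>i. l i * v m i" "v (Suc m)"] by simp
  also have "nrm n (v (Suc m)) = 1" using v_unit[OF m False] by (simp add: ip_self_eq_1_iff)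
  also have "nrm n (\<lambda>i. l i * v m i) \<le> L2_set (\<lambda>i. C * cmod (v m i)) {..<n}"
    unfolding nrm_def by (intro L2_set_mono) (auto simp: norm_mult intro!: mult_right_mono C)
  also have "\<dots> = C * nrm n (v m)" unfolding nrm_def using C(1) by (rule L2_set_right_distrib[symmetric])
  also have "nrm n (v m) = 1" using ip_v_self[OF m order_refl] by (simp add: ip_self_eq_1_iff)
  finally show ?thesis by simp
qed (use C in simp)

end

section \<open>Ritz values, Ritz vectors and best approximation\<close>

text \<open>
  The columns of \<open>W\<close> are orthonormal eigenvectors of the projected matrix \<open>T\<close>, and \<open>\<theta>\<close> are its
  eigenvalues, the Ritz values.
\<close>

locale lanczos_ritz = lanczos_recurrence +
  fixes W :: "nat \<Rightarrow> nat \<Rightarrow> complex" and \<theta> :: "nat \<Rightarrow> real"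
  assumes W_cols: "k < m \<Longrightarrow> k' < m \<Longrightarrow> (\<Sum>p<m. W p k * cnj (W p k')) = (if k = k' then 1 else 0)"
    and W_rows: "p < m \<Longrightarrow> q < m \<Longrightarrow> (\<Sum>k<m. W p k * cnj (W q k)) = (if p = q then 1 else 0)"
    and T_W: "p < m \<Longrightarrow> k < m \<Longrightarrow> (\<Sum>q<m. T p q * W q k) = \<theta> k * W p k"
begin

definition y :: "nat \<Rightarrow> nat \<Rightarrow> complex" where
  "y k i = (\<Sum>p<m. W p k * v (Suc p) i)"

lemma ip_y_right: "ip n x (y k) = (\<Sum>p<m. cnj (W p k) * ip n x (v (Suc p)))"
  unfolding y_def[abs_def] by (simp add: ip_linear)

lemma ip_y_y: 
  assumes "k < m" "k' < m"
  shows "ip n (y k) (y k') = (if k = k' then 1 else 0)"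
proof -
  have "ip n (y k) (v (Suc p)) = W p k" if "p < m" for p
  proof -
    have "ip n (y k) (v (Suc p)) = (\<Sum>q<m. W q k * ip n (v (Suc q)) (v (Suc p)))"
      unfolding y_def[abs_def] by (simp add: ip_linear)
    also have "\<dots> = (\<Sum>q<m. if q = p then W q k else 0)"
      using that by (intro sum.cong) (auto simp: ip_v)
    finally show ?thesis using that by (simp add: sum.delta)
  qed
  hence "ip n (y k) (y k') = (\<Sum>p<m. W p k * cnj (W p k'))"
    unfolding ip_y_right by (intro sum.cong) (auto simp: mult.commute)
  thus ?thesis using W_cols[OF assms] by simp
qed

lemma ip_ritz_sum:
  assumes "k < m"
  shows "ip n (\<lambda>i. \<Sum>j<m. a j * y j i) (y k) = a k"
proof -
  have "ip n (\<lambda>i. \<Sum>j<m. a j * y j i) (y k) = (\<Sum>j<m. if j = k then a j else 0)"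
    unfolding ip_sum_left ip_scale_left using assms by (intro sum.cong refl) (simp add: ip_y_y)
  thus ?thesis using assms by simp
qed

lemma ip_v_Suc_y: "ip n (v (Suc m)) (y k) = 0"
  by (simp add: ip_y_right ip_v)

text \<open>
  The residual of a Ritz pair is a multiple of \<open>v (Suc m)\<close>: in \<open>A V\<^sub>m = V\<^sub>m T\<^sub>m + \<beta>\<^sub>m\<^sub>+\<^sub>1 v\<^sub>m\<^sub>+\<^sub>1 e\<^sub>m*\<close>,
  applied to an eigenvector of \<open>T\<^sub>m\<close>, only the last entry of the eigenvector meets the second term.
\<close>

lemma y_residual:
  assumes k: "k < m" and i: "i < n"
  shows "l i * y k i = \<theta> k * y k i + \<beta> (Suc m) * W (m - 1) k * v (Suc m) i"
proof -
  have "l i * y k i = (\<Sum>q<m. W q k * (l i * v (Suc q) i))"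
    by (simp add: y_def sum_distrib_left mult_ac)
  also have "\<dots> = (\<Sum>q<m. W q k * (\<Sum>p<m. T p q * v (Suc p) i)) +
      (\<Sum>q<m. if q = m - 1 then W q k * \<beta> (Suc m) * v (Suc m) i else 0)"
    unfolding sum.distrib[symmetric] using m i
    by (intro sum.cong refl) (auto simp: T_expansion algebra_simps simp del: of_real_mult)
  also have "(\<Sum>q<m. W q k * (\<Sum>p<m. T p q * v (Suc p) i)) =
      (\<Sum>p<m. (\<Sum>q<m. T p q * W q k) * v (Suc p) i)"
    unfolding sum_distrib_left sum_distrib_right by (subst sum.swap) (simp add: mult_ac)
  also have "\<dots> = \<theta> k * y k i"
    unfolding y_def sum_distrib_left
    by (intro sum.cong refl) (simp add: T_W[OF _ k] mult.assoc)
  finally show ?thesis using m by (simp add: sum.delta mult_ac)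
qed

lemma v_eq_sum_y:
  assumes "p < m"
  shows "v (Suc p) i = (\<Sum>k<m. cnj (W p k) * y k i)"
proof -
  have "(\<Sum>k<m. cnj (W p k) * y k i) = (\<Sum>q<m. (\<Sum>k<m. W q k * cnj (W p k)) * v (Suc q) i)"
    unfolding y_def sum_distrib_left sum_distrib_right by (subst sum.swap) (simp add: mult_ac)
  also have "\<dots> = (\<Sum>q<m. if q = p then v (Suc q) i else 0)"
    using assms by (intro sum.cong) (auto simp: W_rows)
  finally show ?thesis using assms by (simp add: sum.delta)
qed

text \<open>
  With the eigenvalues as nodes, the Newton polynomial of degree \<open>r\<close>, evaluated at \<open>T\<close> and
  applied to the first unit vector, vanishes below row \<open>r\<close>: each factor \<open>T - \<theta>\<^sub>s\<close> moves the
  support down by at most one row, as \<open>T\<close> has no entries below its subdiagonal.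
\<close>

lemma hessenberg_newton:
  assumes "r < p" "p < m"
  shows "(\<Sum>k<m. W p k * (\<Prod>s<r. complex_of_real (\<theta> k - \<theta> s)) * cnj (W 0 k)) = 0"
  using assms
proof (induction r arbitrary: p)
  case 0
  thus ?case using W_rows[of p 0] by simp
next
  case (Suc r)
  define X where "X k = (\<Prod>s<r. complex_of_real (\<theta> k - \<theta> s)) * cnj (W 0 k)" for k
  have IH: "(\<Sum>k<m. W p k * X k) = 0" if "r < p" "p < m" for p
    using Suc.IH[of p] that by (simp add: X_def mult.assoc)
  have "(\<Sum>k<m. W p k * (\<Prod>s<Suc r. complex_of_real (\<theta> k - \<theta> s)) * cnj (W 0 k)) =
    (\<Sum>k<m. (\<theta> k * W p k) * X k) - \<theta> r * (\<Sum>k<m. W p k * X k)"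
    by (simp add: X_def algebra_simps sum_subtractf sum_distrib_left)
  also have "(\<Sum>k<m. W p k * X k) = 0" using Suc.prems by (intro IH) auto
  also have "(\<Sum>k<m. (\<theta> k * W p k) * X k) = (\<Sum>k<m. (\<Sum>q<m. T p q * W q k) * X k)"
    using Suc.prems by (simp add: T_W)
  also have "\<dots> = (\<Sum>q<m. T p q * (\<Sum>k<m. W q k * X k))"
    unfolding sum_distrib_left sum_distrib_right by (subst sum.swap) (simp add: mult_ac)
  also have "\<dots> = 0"
  proof (rule sum.neutral, rule ballI)
    fix q assume "q \<in> {..<m}"
    hence q: "q < m" by simp
    show "T p q * (\<Sum>k<m. W q k * X k) = 0"
    proof (cases "r < q")
      case True
      thus ?thesis using IH q by simp
    next
      case False
      thus ?thesis using Suc.prems q by (simp add: T_eq)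
    qed
  qed
  finally show ?case by simp
qed

text \<open>
  The Krylov space, spanned by the Ritz vectors, consists of polynomials of degree below \<open>m\<close>
  applied to the starting vector.
\<close>

lemma ritz_combination_poly:
  obtains q where "degree q \<le> m - 1"
    "\<And>i. i < n \<Longrightarrow> poly q (complex_of_real (l i)) * v 1 i = (\<Sum>k<m. d k * y k i)"
proof -
  have "\<forall>p. \<exists>P. p < m \<longrightarrow> degree P \<le> m - 1 \<and>
      (\<forall>i<n. v (Suc p) i = poly P (complex_of_real (l i)) * v 1 i)"
  proof
    fix p
    show "\<exists>P. p < m \<longrightarrow> degree P \<le> m - 1 \<and>
      (\<forall>i<n. v (Suc p) i = poly P (complex_of_real (l i)) * v 1 i)"
    proof (cases "p < m")
      case True
      then obtain P where "degree P = p" "\<And>i. i < n \<Longrightarrow> v (Suc p) i = poly P (complex_of_real (l i)) * v 1 i"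
        using lanczos_poly[of "Suc p"] by auto
      thus ?thesis using True by (intro exI[of _ P]) simp
    qed simp
  qed
  then obtain P where P: "\<And>p. p < m \<Longrightarrow> degree (P p) \<le> m - 1"
    "\<And>p i. p < m \<Longrightarrow> i < n \<Longrightarrow> v (Suc p) i = poly (P p) (complex_of_real (l i)) * v 1 i"
    by metis
  define q where "q = (\<Sum>k<m. \<Sum>p<m. Polynomial.smult (d k * W p k) (P p))"
  show ?thesis
  proof (rule that[of q])
    show "degree q \<le> m - 1" unfolding q_def
      by (intro degree_sum_le order_trans[OF degree_smult_le P(1)]) simp_all
    show "poly q (complex_of_real (l i)) * v 1 i = (\<Sum>k<m. d k * y k i)" if i: "i < n" for i
    proof -
      have "poly q (complex_of_real (l i)) * v 1 i =
        (\<Sum>k<m. \<Sum>p<m. d k * (W p k * (poly (P p) (complex_of_real (l i)) * v 1 i)))"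
        by (simp add: q_def poly_sum sum_distrib_right mult.assoc)
      also have "\<dots> = (\<Sum>k<m. \<Sum>p<m. d k * (W p k * v (Suc p) i))"
        by (intro sum.cong refl) (simp only: lessThan_iff P(2)[OF _ i, symmetric])
      finally show ?thesis by (simp only: y_def sum_distrib_left)
    qed
  qed
qed

lemma projection_residual_orthogonal:
  assumes "k < m"
  shows "ip n (\<lambda>i. x i - (\<Sum>k<m. ip n x (y k) * y k i)) (y k) = 0"
  unfolding ip_diff_left ip_ritz_sum[OF assms] by simp

text \<open>
  The projection onto the Krylov space is itself given by a polynomial \<open>q\<close>. Its residual is
  orthogonal to \<open>q(A) b - p(A) b\<close>, and the theorem of Pythagoras compares it with the
  residual of any other \<open>p\<close>.
\<close>

lemma projection_is_best:
  fixes x :: "nat \<Rightarrow> complex"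
  obtains q where "degree q \<le> m - 1"
    "\<And>i. i < n \<Longrightarrow> poly q (complex_of_real (l i)) * v 1 i = (\<Sum>k<m. ip n x (y k) * y k i)"
    "\<And>p. degree p \<le> m - 1 \<Longrightarrow> nrm n (\<lambda>i. x i - poly q (complex_of_real (l i)) * v 1 i)
        \<le> nrm n (\<lambda>i. x i - poly p (complex_of_real (l i)) * v 1 i)"
proof -
  obtain q where q: "degree q \<le> m - 1"
    "\<And>i. i < n \<Longrightarrow> poly q (complex_of_real (l i)) * v 1 i = (\<Sum>k<m. ip n x (y k) * y k i)"
    using ritz_combination_poly[of "\<lambda>k. ip n x (y k)"] by blast
  define r where "r i = x i - poly q (complex_of_real (l i)) * v 1 i" for i
  have r_y: "ip n r (y k) = 0" if "k < m" for k
  proof -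
    have "ip n r (y k) = ip n (\<lambda>i. x i - (\<Sum>k<m. ip n x (y k) * y k i)) (y k)"
      using q(2) by (intro ip_cong) (simp_all add: r_def)
    thus ?thesis using projection_residual_orthogonal[OF that] by simp
  qed
  have r_v: "ip n r (v j) = 0" if "1 \<le> j" "j \<le> m" for j
  proof -
    have "j - 1 < m" using that by simp
    have "ip n r (v j) = ip n r (\<lambda>i. \<Sum>k<m. cnj (W (j - 1) k) * y k i)"
      using v_eq_sum_y[OF \<open>j - 1 < m\<close>] that by (intro ip_cong) simp_all
    thus ?thesis using r_y unfolding ip_sum_right ip_scale_right by simp
  qed
  show ?thesis
  proof (rule that[OF q])
    fix p :: "complex poly" assume p: "degree p \<le> m - 1"
    let ?s = "\<lambda>i. poly (q - p) (complex_of_real (l i)) * v 1 i"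
    have "ip n r ?s = 0"
      using q(1) p by (intro orthogonal_poly r_v degree_diff_le)
    hence "(nrm n (\<lambda>i. r i + ?s i))\<^sup>2 = (nrm n r)\<^sup>2 + (nrm n ?s)\<^sup>2" by (rule nrm_orth_add)
    hence "(nrm n r)\<^sup>2 \<le> (nrm n (\<lambda>i. r i + ?s i))\<^sup>2" by simp
    hence "nrm n r \<le> nrm n (\<lambda>i. r i + ?s i)" by (rule power2_le_imp_le) simp
    also have "(\<lambda>i. r i + ?s i) = (\<lambda>i. x i - poly p (complex_of_real (l i)) * v 1 i)"
      by (simp add: r_def algebra_simps)
    finally show "nrm n (\<lambda>i. x i - poly q (complex_of_real (l i)) * v 1 i)
        \<le> nrm n (\<lambda>i. x i - poly p (complex_of_real (l i)) * v 1 i)"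
      by (simp only: r_def)
  qed
qed

end

section \<open>A sum of simple fractions with constant numerator\<close>

text \<open>
  Put \<open>S\<^sub>r(t) = \<Sum>\<^sub>k a\<^sub>k \<Prod>\<^sub>s\<^sub><\<^sub>r (\<theta>\<^sub>k - \<theta>\<^sub>s) / (\<theta>\<^sub>k + t)\<close>. Writing the next factor as
  \<open>\<theta>\<^sub>k - \<theta>\<^sub>r = (\<theta>\<^sub>k + t) - (\<theta>\<^sub>r + t)\<close> gives \<open>S\<^sub>r\<^sub>+\<^sub>1 = c\<^sub>r - (\<theta>\<^sub>r + t) S\<^sub>r\<close>, where \<open>c\<^sub>r\<close> is the
  sum without denominators. The hypothesis makes all \<open>c\<^sub>r\<close> but the last one vanish, and \<open>S\<^sub>m = 0\<close>
  because every product then contains a zero factor. So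
  \<open>S\<^sub>0(t) \<Prod>\<^sub>k (\<theta>\<^sub>k + t)\<close> is \<open>c\<^sub>m\<^sub>-\<^sub>1\<close> up to sign. The nodes may coincide.
\<close>

lemma partial_fractions_numerator_constant:
  fixes a :: "nat \<Rightarrow> complex" and \<theta> :: "nat \<Rightarrow> real"
  assumes "1 \<le> m"
    and "\<And>r. Suc r < m \<Longrightarrow> (\<Sum>k<m. a k * (\<Prod>s<r. complex_of_real (\<theta> k - \<theta> s))) = 0"
  shows "\<exists>C. \<forall>t. (\<forall>k<m. \<theta> k + t \<noteq> 0) \<longrightarrow>
    (\<Sum>k<m. a k / complex_of_real (\<theta> k + t)) = C / (\<Prod>k<m. complex_of_real (\<theta> k + t))"
proof -
  define c where "c r = (\<Sum>k<m. a k * (\<Prod>s<r. complex_of_real (\<theta> k - \<theta> s)))" for r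
  define S where "S t r = (\<Sum>k<m. a k * (\<Prod>s<r. complex_of_real (\<theta> k - \<theta> s)) / complex_of_real (\<theta> k + t))" for t r
  have "S t 0 = (-1) ^ (m - 1) * c (m - 1) / (\<Prod>k<m. complex_of_real (\<theta> k + t))"
    if t: "\<forall>k<m. \<theta> k + t \<noteq> 0" for t
  proof -
    have step: "S t (Suc r) = c r - complex_of_real (\<theta> r + t) * S t r" for r
    proof -
      have "a k * (\<Prod>s<Suc r. complex_of_real (\<theta> k - \<theta> s)) / complex_of_real (\<theta> k + t) =
        a k * (\<Prod>s<r. complex_of_real (\<theta> k - \<theta> s)) -
        complex_of_real (\<theta> r + t) * (a k * (\<Prod>s<r. complex_of_real (\<theta> k - \<theta> s)) / complex_of_real (\<theta> k + t))"
        if "k < m" for k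
      proof -
        define P where "P = (\<Prod>s<r. complex_of_real (\<theta> k - \<theta> s))"
        have "complex_of_real (\<theta> k - \<theta> r) = complex_of_real (\<theta> k + t) - complex_of_real (\<theta> r + t)"
          by simp
        moreover have "complex_of_real (\<theta> k + t) \<noteq> 0" using t that by (simp del: of_real_add)
        ultimately show ?thesis
          by (simp add: P_def[symmetric] diff_divide_distrib right_diff_distrib mult_ac del: of_real_add of_real_diff)
      qed
      thus ?thesis unfolding S_def c_def sum_distrib_left
        by (simp add: sum_subtractf[symmetric] del: prod.lessThan_Suc of_real_add of_real_diff)
    qed
    have main: "S t r = (-1) ^ r * (\<Prod>k<r. complex_of_real (\<theta> k + t)) * S t 0" if "r \<le> m - 1" for r
      using that
    proof (induction r)
      case (Suc r)
      have "c r = 0" unfolding c_def using assms(2)[of r] Suc.prems by simp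
      thus ?case using step[of r] Suc by simp
    qed simp
    \<comment> \<open>The factor with \<open>s = k\<close> is zero.\<close>
    have z: "S t (Suc (m - 1)) = 0"
      unfolding S_def using assms(1) by (intro sum.neutral ballI) (auto simp: prod_zero_iff)
    have "c (m - 1) = complex_of_real (\<theta> (m - 1) + t) * S t (m - 1)" using step[of "m - 1"] z by simp
    also have "\<dots> = (-1) ^ (m - 1) * ((\<Prod>k<m - 1. complex_of_real (\<theta> k + t)) * complex_of_real (\<theta> (m - 1) + t)) * S t 0"
      by (subst main) (simp_all add: mult_ac)
    also have "(\<Prod>k<m - 1. complex_of_real (\<theta> k + t)) * complex_of_real (\<theta> (m - 1) + t) = (\<Prod>k<m. complex_of_real (\<theta> k + t))"
      using assms(1) prod.lessThan_Suc[of "\<lambda>k. complex_of_real (\<theta> k + t)" "m - 1"] by simp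
    finally have "(-1) ^ (m - 1) * c (m - 1) = ((-1) ^ (m - 1) * (-1) ^ (m - 1)) * (\<Prod>k<m. complex_of_real (\<theta> k + t)) * S t 0"
      by (simp add: mult_ac)
    also have "(-1) ^ (m - 1) * (-1) ^ (m - 1) = (1 :: complex)"
      by (simp flip: power_mult_distrib)
    finally show ?thesis using t by (simp add: field_simps del: of_real_add)
  qed
  moreover have "S t 0 = (\<Sum>k<m. a k / complex_of_real (\<theta> k + t))" for t by (simp add: S_def)
  ultimately show ?thesis by (intro exI[of _ "(-1) ^ (m - 1) * c (m - 1)"]) simp
qed

section \<open>The Lanczos error for Stieltjes functions\<close>

text \<open>
  Restricting the measure to the half line removes the indicator functions from the integrals.
\<close>

lemma stieltjes_function_as_integral:
  assumes "stieltjes_function g"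
  obtains N :: "real measure" where "space N \<subseteq> {0..}" "(\<lambda>t. t) \<in> borel_measurable N"
    "integrable N (\<lambda>t. 1 / (1 + t))" "\<And>z. 0 < z \<Longrightarrow> g z = (\<integral>t. 1 / (z + t) \<partial>N)"
proof -
  obtain \<mu> where \<mu>: "set_integrable (stieltjes_measure \<mu>) {0..} (\<lambda>t. 1 / (1 + t))"
    and g: "\<And>z. z > 0 \<Longrightarrow> g z = (LINT t:{0..}|stieltjes_measure \<mu>. 1 / (z + t))"
    using assms unfolding stieltjes_function_def by blast
  have [simp]: "sets (stieltjes_measure \<mu>) = sets borel" "space (stieltjes_measure \<mu>) = UNIV"
    by (simp_all add: stieltjes_measure_def)
  let ?N = "restrict_space (stieltjes_measure \<mu>) {0..}"
  show ?thesis
  proof (rule that[of ?N])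
    show "space ?N \<subseteq> {0..}" by (simp add: space_restrict_space)
    have "(\<lambda>t. t) \<in> borel_measurable (stieltjes_measure \<mu>)"
      by (subst measurable_cong_sets[where M' = borel and N' = borel]) simp_all
    thus "(\<lambda>t. t) \<in> borel_measurable ?N" by (rule measurable_restrict_space1)
    show "integrable ?N (\<lambda>t. 1 / (1 + t))"
      using \<mu> by (subst integrable_restrict_space) (auto simp: set_integrable_def)
    show "g z = (\<integral>t. 1 / (z + t) \<partial>?N)" if "0 < z" for z
      using g[OF that] by (subst integral_restrict_space) (auto simp: set_lebesgue_integral_def)
  qed
qed

lemma integrable_bounded_over_shift:
  fixes u :: "real \<Rightarrow> real"
  assumes N: "space N \<subseteq> {0..}" "(\<lambda>t. t) \<in> borel_measurable N" "integrable N (\<lambda>t. 1 / (1 + t))"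
    and c: "0 < c" and u: "u \<in> borel_measurable N" "\<And>t. 0 \<le> t \<Longrightarrow> \<bar>u t\<bar> \<le> B"
  shows "integrable N (\<lambda>t. u t / (c + t))"
proof (rule Bochner_Integration.integrable_bound)
  define K where "K = max 1 (1 / c)"
  have "1 / c \<le> K" by (simp add: K_def)
  hence K: "1 \<le> K * c" "1 \<le> K" using c by (simp_all only: pos_divide_le_eq) (simp add: K_def)
  show "integrable N (\<lambda>t. B * K * (1 / (1 + t)))" using N(3) by (rule integrable_mult_right)
  note [measurable] = N(2) u(1)
  show "(\<lambda>t. u t / (c + t)) \<in> borel_measurable N" by measurable
  show "AE t in N. norm (u t / (c + t)) \<le> norm (B * K * (1 / (1 + t)))"
  proof (rule AE_I2)
    fix t assume "t \<in> space N"
    hence t: "0 \<le> t" using N(1) by auto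
    have "t \<le> K * t" using mult_right_mono[OF K(2) t] by simp
    hence "1 + t \<le> K * (c + t)" using K(1) by (simp only: distrib_left)
    hence "1 / (c + t) \<le> K * (1 / (1 + t))" using t c by (simp add: divide_simps mult.commute)
    hence "\<bar>u t\<bar> * (1 / (c + t)) \<le> B * (K * (1 / (1 + t)))"
      using u(2)[OF t] t c by (intro mult_mono) (auto intro: order_trans[OF abs_ge_zero])
    also have "\<dots> \<le> norm (B * K * (1 / (1 + t)))" using abs_ge_self[of "B * K * (1 / (1 + t))"] by simp
    finally show "norm (u t / (c + t)) \<le> norm (B * K * (1 / (1 + t)))"
      using t c by (simp add: abs_mult)
  qed
qed

text \<open>
  Here \<open>c\<close> is a positive lower bound of the spectrum, to be instantiated by the smallest
  eigenvalue.
\<close>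

locale stieltjes_lanczos = lanczos_ritz +
  fixes N :: "real measure" and f :: "real \<Rightarrow> real" and c :: real
  assumes N: "space N \<subseteq> {0..}" "(\<lambda>t. t) \<in> borel_measurable N" "integrable N (\<lambda>t. 1 / (1 + t))"
    and f_eq: "0 < z \<Longrightarrow> f z = z * (\<integral>t. 1 / (z + t) \<partial>N)"
    and c: "0 < c" "i < n \<Longrightarrow> c \<le> l i"
    and beta_nonneg: "0 \<le> \<beta> (Suc m)"
begin

text \<open>
  A Ritz value is the Rayleigh quotient of its Ritz vector.
\<close>

lemma theta_ge:
  assumes k: "k < m"
  shows "c \<le> \<theta> k"
proof -
  have y1: "(\<Sum>i<n. (cmod (y k i))\<^sup>2) = 1"
  proof -
    have "complex_of_real (\<Sum>i<n. (cmod (y k i))\<^sup>2) = ip n (y k) (y k)"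
      by (simp only: ip_def of_real_sum complex_norm_square)
    also have "\<dots> = complex_of_real 1" using ip_y_y[OF k k] by simp
    finally show ?thesis by (simp only: of_real_eq_iff)
  qed
  have "complex_of_real (\<Sum>i<n. l i * (cmod (y k i))\<^sup>2) = ip n (\<lambda>i. l i * y k i) (y k)"
    by (simp only: ip_def of_real_sum of_real_mult complex_norm_square mult.assoc)
  also have "\<dots> = ip n (\<lambda>i. \<theta> k * y k i + \<beta> (Suc m) * W (m - 1) k * v (Suc m) i) (y k)"
    using k by (intro ip_cong y_residual refl)
  also have "\<dots> = complex_of_real (\<theta> k)"
    using k by (simp add: ip_linear ip_y_y ip_v_Suc_y)
  finally have "\<theta> k = (\<Sum>i<n. l i * (cmod (y k i))\<^sup>2)" by (simp only: of_real_eq_iff)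
  also have "\<dots> \<ge> (\<Sum>i<n. c * (cmod (y k i))\<^sup>2)"
    by (intro sum_mono mult_right_mono c) auto
  finally show ?thesis by (simp add: sum_distrib_left[symmetric] y1)
qed

lemma theta_pos: "k < m \<Longrightarrow> 0 < \<theta> k" and l_pos: "i < n \<Longrightarrow> 0 < l i"
  using theta_ge[of k] c(1) c(2)[of i] by auto

text \<open>
  Up to a constant, the corner entry of the inverse of \<open>T + t\<close>; it is positive for \<open>t \<ge> 0\<close>.
\<close>

definition w :: "real \<Rightarrow> real" where
  "w t = 1 / (\<Prod>k<m. \<theta> k + t)"

lemma t_measurable [measurable]: "(\<lambda>t. t) \<in> borel_measurable N"
  by (fact N(2))

lemma w_measurable [measurable]: "w \<in> borel_measurable N"
  unfolding w_def[abs_def] by measurable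

lemma w_nonneg: "0 \<le> t \<Longrightarrow> 0 \<le> w t"
  unfolding w_def
  by (intro divide_nonneg_nonneg prod_nonneg add_nonneg_nonneg) (auto intro: less_imp_le[OF theta_pos])

text \<open>
  One factor of the product suffices for integrability against the Stieltjes measure; the others
  are bounded. This factor exists as \<open>m \<ge> 1\<close>.
\<close>

lemma integrable_w:
  assumes u: "u \<in> borel_measurable N" "\<And>t. 0 \<le> t \<Longrightarrow> \<bar>u t\<bar> \<le> B"
  shows "integrable N (\<lambda>t. u t * w t)"
proof -
  define P where "P t = (\<Prod>k<m - 1. \<theta> k + t)" for t
  have P0: "0 < P 0" unfolding P_def by (intro prod_pos) (auto intro: theta_pos)
  have P: "P 0 \<le> P t" if "0 \<le> t" for t
    unfolding P_def using that by (intro prod_mono) (auto intro: less_imp_le[OF theta_pos])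
  have [measurable]: "P \<in> borel_measurable N" unfolding P_def[abs_def] by measurable
  have "integrable N (\<lambda>t. (u t / P t) / (\<theta> (m - 1) + t))"
  proof (rule integrable_bounded_over_shift[OF N, where B = "B / P 0"])
    show "0 < \<theta> (m - 1)" using theta_pos m by simp
    show "(\<lambda>t. u t / P t) \<in> borel_measurable N" using u(1) by measurable
    show "\<bar>u t / P t\<bar> \<le> B / P 0" if "0 \<le> t" for t
      using u(2)[OF that] P[OF that] P0 unfolding abs_divide
      by (intro frac_le) (auto intro: order_trans[OF abs_ge_zero])
  qed
  moreover have "w t = 1 / (P t * (\<theta> (m - 1) + t))" for t
    using m prod.lessThan_Suc[of "\<lambda>k. \<theta> k + t" "m - 1"] by (simp add: w_def P_def)
  ultimately show ?thesis by (simp add: mult_ac)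
qed

lemma integrable_shift_w: "i < n \<Longrightarrow> integrable N (\<lambda>t. t / (l i + t) * w t)"
  by (rule integrable_w[where B = 1]) (use l_pos[of i] in auto)

definition G :: "nat \<Rightarrow> real" where
  "G i = (\<integral>t. t / (l i + t) * w t \<partial>N)"

lemma f_diff:
  assumes "0 < x" "0 < z"
  shows "f x - f z = (x - z) * (\<integral>t. t / ((x + t) * (z + t)) \<partial>N)"
proof -
  have int: "integrable N (\<lambda>t. s / (s + t))" if "0 < s" for s
    using integrable_bounded_over_shift[OF N that, of "\<lambda>t. s" s] that by simp
  have "f x - f z = (\<integral>t. x / (x + t) \<partial>N) - (\<integral>t. z / (z + t) \<partial>N)"
    using assms by (simp add: f_eq flip: integral_mult_right_zero)
  also have "\<dots> = (\<integral>t. x / (x + t) - z / (z + t) \<partial>N)"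
    using int assms by (intro Bochner_Integration.integral_diff[symmetric])
  also have "\<dots> = (\<integral>t. (x - z) * (t / ((x + t) * (z + t))) \<partial>N)"
  proof (intro Bochner_Integration.integral_cong refl)
    fix t assume "t \<in> space N"
    hence "x + t > 0" "z + t > 0" using N(1) assms by fastforce+
    thus "x / (x + t) - z / (z + t) = (x - z) * (t / ((x + t) * (z + t)))"
      by (simp add: divide_simps) (simp add: algebra_simps)
  qed
  finally show ?thesis by (simp only: integral_mult_right_zero)
qed

text \<open>
  The error of the Lanczos approximation. The starting vector is \<open>v 1\<close>, and its coefficient with
  respect to \<open>y k\<close> is \<open>cnj (W 0 k)\<close>.
\<close>

definition E :: "nat \<Rightarrow> complex" where
  "E i = f (l i) * v 1 i - (\<Sum>k<m. f (\<theta> k) * cnj (W 0 k) * y k i)"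

text \<open>
  The central formula. The dependence on \<open>k\<close> is summed up before the integration, and what
  remains is a constant times a positive weight that does not depend on \<open>k\<close>.
\<close>

lemma E_eq: "\<exists>C::complex. \<forall>i<n. E i = \<beta> (Suc m) * C * (v (Suc m) i * G i)"
proof -
  define a where "a k = W (m - 1) k * cnj (W 0 k)" for k
  have "(\<Sum>k<m. a k * (\<Prod>s<r. complex_of_real (\<theta> k - \<theta> s))) = 0" if "Suc r < m" for r
    using hessenberg_newton[of r "m - 1"] that by (simp add: a_def mult_ac)
  from partial_fractions_numerator_constant[OF m this] obtain C where
    C: "\<And>t. \<forall>k<m. \<theta> k + t \<noteq> 0 \<Longrightarrow>
      (\<Sum>k<m. a k / complex_of_real (\<theta> k + t)) = C / (\<Prod>k<m. complex_of_real (\<theta> k + t))"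
    by blast
  have eq: "E i = \<beta> (Suc m) * C * (v (Suc m) i * G i)" if i: "i < n" for i
  proof -
    define D where "D k = (\<integral>t. t / ((l i + t) * (\<theta> k + t)) \<partial>N)" for k
    have int: "integrable N (\<lambda>t. t / ((l i + t) * (\<theta> k + t)))" if "k < m" for k
    proof -
      have "integrable N (\<lambda>t. (t / (l i + t)) / (\<theta> k + t))"
        by (rule integrable_bounded_over_shift[OF N, where B = 1])
          (use l_pos[OF i] theta_pos[OF that] in auto)
      thus ?thesis by simp
    qed
    have "E i = (\<Sum>k<m. cnj (W 0 k) * ((f (l i) - f (\<theta> k)) * y k i))"
      using v_eq_sum_y[of 0 i] m unfolding E_def
      by (simp add: sum_distrib_left algebra_simps sum_subtractf)
    also have "\<dots> = (\<Sum>k<m. \<beta> (Suc m) * v (Suc m) i * (a k * D k))"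
    proof (intro sum.cong refl)
      fix k assume "k \<in> {..<m}"
      hence k: "k < m" by simp
      have "(complex_of_real (f (l i)) - f (\<theta> k)) * y k i = D k * ((l i - \<theta> k) * y k i)"
        using f_diff[OF l_pos[OF i] theta_pos[OF k]] unfolding D_def
        by (simp flip: of_real_diff)
      also have "complex_of_real (l i - \<theta> k) * y k i = \<beta> (Suc m) * W (m - 1) k * v (Suc m) i"
        using y_residual[OF k i] by (simp add: algebra_simps)
      finally show "cnj (W 0 k) * ((f (l i) - f (\<theta> k)) * y k i) = \<beta> (Suc m) * v (Suc m) i * (a k * D k)"
        by (simp add: a_def mult_ac)
    qed
    also have "\<dots> = \<beta> (Suc m) * v (Suc m) i * (\<Sum>k<m. a k * D k)"
      by (simp only: sum_distrib_left)
    also have "(\<Sum>k<m. a k * D k) = (\<Sum>k<m. \<integral>t. a k * complex_of_real (t / ((l i + t) * (\<theta> k + t))) \<partial>N)"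
      unfolding D_def by (simp only: integral_mult_right_zero integral_complex_of_real)
    also have "\<dots> = (\<integral>t. (\<Sum>k<m. a k * complex_of_real (t / ((l i + t) * (\<theta> k + t)))) \<partial>N)"
      using int by (intro Bochner_Integration.integral_sum[symmetric] integrable_mult_right integrable_of_real) auto
    also have "\<dots> = (\<integral>t. C * complex_of_real (t / (l i + t) * w t) \<partial>N)"
    proof (intro Bochner_Integration.integral_cong refl)
      fix t assume "t \<in> space N"
      hence "0 \<le> t" using N(1) by auto
      hence nz: "\<forall>k<m. \<theta> k + t \<noteq> 0" using theta_pos by (metis add_pos_nonneg less_irrefl)
      have "(\<Sum>k<m. a k * complex_of_real (t / ((l i + t) * (\<theta> k + t)))) =
        complex_of_real (t / (l i + t)) * (\<Sum>k<m. a k / complex_of_real (\<theta> k + t))"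
        by (simp add: sum_distrib_left mult_ac)
      also have "\<dots> = C * complex_of_real (t / (l i + t) * w t)"
        unfolding C[OF nz] by (simp add: w_def)
      finally show "(\<Sum>k<m. a k * complex_of_real (t / ((l i + t) * (\<theta> k + t)))) =
        C * complex_of_real (t / (l i + t) * w t)" .
    qed
    also have "\<dots> = C * G i"
      unfolding G_def by (simp only: integral_mult_right_zero integral_complex_of_real)
    finally show ?thesis by (simp only: mult_ac)
  qed
  show ?thesis by (intro exI[of _ C] allI impI eq)
qed

text \<open>
  The quadratic form of the inverse of \<open>A + t\<close> at \<open>v (Suc m)\<close>.
\<close>

definition \<phi> :: "real \<Rightarrow> real" where
  "\<phi> t = (\<Sum>i<n. (cmod (v (Suc m) i))\<^sup>2 / (l i + t))"

lemma phi_measurable [measurable]: "\<phi> \<in> borel_measurable N"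
  unfolding \<phi>_def[abs_def] by measurable

lemma phi_nonneg: "0 \<le> t \<Longrightarrow> 0 \<le> \<phi> t"
  unfolding \<phi>_def
  by (intro sum_nonneg divide_nonneg_nonneg add_nonneg_nonneg) (auto intro: less_imp_le[OF l_pos])

lemma t_phi_w: "t * \<phi> t * w t = (\<Sum>i<n. (cmod (v (Suc m) i))\<^sup>2 * (t / (l i + t) * w t))"
  by (simp add: \<phi>_def sum_distrib_left sum_distrib_right mult_ac)

lemma integrable_t_phi_w: "integrable N (\<lambda>t. t * \<phi> t * w t)"
  unfolding t_phi_w by (intro Bochner_Integration.integrable_sum integrable_mult_right integrable_shift_w) simp

text \<open>
  Up to the factor \<open>\<beta> (Suc m) * C\<close> from the formula for the error, this is the inner product
  of the error with \<open>v (Suc m)\<close>.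
\<close>

definition J :: real where
  "J = (\<integral>t. t * \<phi> t * w t \<partial>N)"

lemma t_phi_w_nonneg: "0 \<le> t \<Longrightarrow> 0 \<le> t * \<phi> t * w t"
  by (intro mult_nonneg_nonneg phi_nonneg w_nonneg)

lemma N_nonneg: "t \<in> space N \<Longrightarrow> 0 \<le> t"
  using N(1) by auto

lemma J_nonneg: "0 \<le> J"
  unfolding J_def by (intro integral_nonneg_AE AE_I2 t_phi_w_nonneg N_nonneg)

lemma ip_vG_v: "ip n (\<lambda>i. v (Suc m) i * G i) (v (Suc m)) = J"
proof -
  have "J = (\<Sum>i<n. \<integral>t. (cmod (v (Suc m) i))\<^sup>2 * (t / (l i + t) * w t) \<partial>N)"
    unfolding J_def t_phi_w
    by (intro Bochner_Integration.integral_sum integrable_mult_right integrable_shift_w) simp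
  also have "\<dots> = (\<Sum>i<n. (cmod (v (Suc m) i))\<^sup>2 * G i)"
    unfolding G_def by (simp only: integral_mult_right_zero)
  finally have "complex_of_real J = (\<Sum>i<n. complex_of_real ((cmod (v (Suc m) i))\<^sup>2) * complex_of_real (G i))"
    by simp
  thus ?thesis unfolding ip_def complex_norm_square by (simp add: mult_ac)
qed

text \<open>
  The component of \<open>(A + t)\<^sup>-\<^sup>1 v\<^sub>m\<^sub>+\<^sub>1\<close> along a Ritz vector. It follows from
  \<open>(\<theta>\<^sub>k + t) y\<^sub>k = (A + t) y\<^sub>k - \<beta>\<^sub>m\<^sub>+\<^sub>1 \<omega>\<^sub>k v\<^sub>m\<^sub>+\<^sub>1\<close> and the orthogonality of \<open>y\<^sub>k\<close> and \<open>v\<^sub>m\<^sub>+\<^sub>1\<close>.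
  The result is small when \<open>\<beta>\<^sub>m\<^sub>+\<^sub>1\<close> is, which makes the final constant close to 1 near convergence.
\<close>

lemma shifted_ritz_projection:
  assumes k: "k < m" and t: "0 \<le> t"
  shows "(\<Sum>i<n. v (Suc m) i * cnj (y k i) / (l i + t)) = - \<beta> (Suc m) * cnj (W (m - 1) k) * (\<phi> t / (\<theta> k + t))"
proof -
  have tk: "complex_of_real (\<theta> k + t) \<noteq> 0" using theta_pos[OF k] t by (simp del: of_real_add)
  have "(\<theta> k + t) * (\<Sum>i<n. v (Suc m) i * cnj (y k i) / (l i + t)) =
    (\<Sum>i<n. v (Suc m) i * cnj (y k i) -
      \<beta> (Suc m) * cnj (W (m - 1) k) * complex_of_real ((cmod (v (Suc m) i))\<^sup>2 / (l i + t)))"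
    unfolding sum_distrib_left
  proof (intro sum.cong refl)
    fix i assume "i \<in> {..<n}"
    hence i: "i < n" by simp
    have lt: "complex_of_real (l i + t) \<noteq> 0" using l_pos[OF i] t by (simp del: of_real_add)
    have "cnj (l i * y k i) = cnj (\<theta> k * y k i + \<beta> (Suc m) * W (m - 1) k * v (Suc m) i)"
      by (simp only: y_residual[OF k i])
    hence *: "(\<theta> k + t) * cnj (y k i) = (l i + t) * cnj (y k i) - \<beta> (Suc m) * cnj (W (m - 1) k) * cnj (v (Suc m) i)"
      by (simp add: algebra_simps)
    have "complex_of_real (\<theta> k + t) * (v (Suc m) i * cnj (y k i) / (l i + t)) =
       v (Suc m) i * ((\<theta> k + t) * cnj (y k i)) / (l i + t)" by simp
    also have "\<dots> = v (Suc m) i * cnj (y k i) * (complex_of_real (l i + t) / (l i + t)) -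
        \<beta> (Suc m) * cnj (W (m - 1) k) * (v (Suc m) i * cnj (v (Suc m) i) / (l i + t))"
      unfolding * by (simp add: diff_divide_distrib right_diff_distrib mult_ac del: of_real_add)
    also have "complex_of_real (l i + t) / (l i + t) = 1" using lt by (rule divide_self)
    also have "v (Suc m) i * cnj (v (Suc m) i) / (l i + t) = complex_of_real ((cmod (v (Suc m) i))\<^sup>2 / (l i + t))"
      by (simp only: of_real_divide complex_norm_square)
    finally show "complex_of_real (\<theta> k + t) * (v (Suc m) i * cnj (y k i) / (l i + t)) =
       v (Suc m) i * cnj (y k i) -
       \<beta> (Suc m) * cnj (W (m - 1) k) * complex_of_real ((cmod (v (Suc m) i))\<^sup>2 / (l i + t))"
      by (simp only: mult_1_right)
  qed
  also have "\<dots> = ip n (v (Suc m)) (y k) - \<beta> (Suc m) * cnj (W (m - 1) k) * \<phi> t"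
    by (simp add: ip_def sum_subtractf \<phi>_def sum_distrib_left)
  finally show ?thesis using tk by (simp add: ip_v_Suc_y divide_simps mult_ac del: of_real_add)
qed

text \<open>
  By the preceding lemma the integrand is the one of \<open>J\<close> with the extra factor
  \<open>1 / (\<theta> k + t)\<close>, which is at most \<open>1 / c\<close>; the integrand of \<open>J\<close> is nonnegative.
\<close>

lemma ip_vG_y:
  assumes k: "k < m"
  shows "cmod (ip n (\<lambda>i. v (Suc m) i * G i) (y k)) \<le> \<beta> (Suc m) / c * cmod (W (m - 1) k) * J"
proof -
  define H where "H = (\<integral>t. 1 / (\<theta> k + t) * (t * \<phi> t * w t) \<partial>N)"
  have sum_eq: "(\<Sum>i<n. v (Suc m) i * cnj (y k i) * complex_of_real (t / (l i + t) * w t)) =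
      - \<beta> (Suc m) * cnj (W (m - 1) k) * complex_of_real (1 / (\<theta> k + t) * (t * \<phi> t * w t))"
    if t: "0 \<le> t" for t
  proof -
    have "(\<Sum>i<n. v (Suc m) i * cnj (y k i) * complex_of_real (t / (l i + t) * w t)) =
      complex_of_real (t * w t) * (\<Sum>i<n. v (Suc m) i * cnj (y k i) / (l i + t))"
      by (simp add: sum_distrib_left mult_ac)
    also have "\<dots> = - \<beta> (Suc m) * cnj (W (m - 1) k) * complex_of_real (1 / (\<theta> k + t) * (t * \<phi> t * w t))"
      unfolding shifted_ritz_projection[OF k t] by (simp add: mult_ac)
    finally show ?thesis .
  qed
  have "ip n (\<lambda>i. v (Suc m) i * G i) (y k) = (\<Sum>i<n. v (Suc m) i * cnj (y k i) * G i)"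
    by (simp add: ip_def mult_ac)
  also have "\<dots> = (\<Sum>i<n. \<integral>t. v (Suc m) i * cnj (y k i) * complex_of_real (t / (l i + t) * w t) \<partial>N)"
    unfolding G_def by (simp only: integral_mult_right_zero integral_complex_of_real)
  also have "\<dots> = (\<integral>t. (\<Sum>i<n. v (Suc m) i * cnj (y k i) * complex_of_real (t / (l i + t) * w t)) \<partial>N)"
    using integrable_shift_w
    by (intro Bochner_Integration.integral_sum[symmetric] integrable_mult_right integrable_of_real) auto
  also have "\<dots> = (\<integral>t. - \<beta> (Suc m) * cnj (W (m - 1) k) * complex_of_real (1 / (\<theta> k + t) * (t * \<phi> t * w t)) \<partial>N)"
    using N(1) by (intro Bochner_Integration.integral_cong refl sum_eq) auto
  also have "\<dots> = - \<beta> (Suc m) * cnj (W (m - 1) k) * H"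
    unfolding H_def by (simp only: integral_mult_right_zero integral_complex_of_real)
  finally have eq: "cmod (ip n (\<lambda>i. v (Suc m) i * G i) (y k)) = \<beta> (Suc m) * cmod (W (m - 1) k) * \<bar>H\<bar>"
    using beta_nonneg by (simp add: norm_mult)
  have "\<bar>H\<bar> \<le> J / c"
  proof -
    have bd: "0 \<le> 1 / (\<theta> k + t)" "1 / (\<theta> k + t) \<le> 1 / c" if "0 \<le> t" for t
      using that theta_ge[OF k] c(1) by (auto intro!: divide_left_mono mult_pos_pos)
    have int: "integrable N (\<lambda>t. 1 / (\<theta> k + t) * (t * \<phi> t * w t))"
    proof (rule Bochner_Integration.integrable_bound)
      show "integrable N (\<lambda>t. 1 / c * (t * \<phi> t * w t))"
        using integrable_t_phi_w by (rule integrable_mult_right)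
      show "(\<lambda>t. 1 / (\<theta> k + t) * (t * \<phi> t * w t)) \<in> borel_measurable N" by measurable
      show "AE t in N. norm (1 / (\<theta> k + t) * (t * \<phi> t * w t)) \<le> norm (1 / c * (t * \<phi> t * w t))"
      proof (rule AE_I2)
        fix t assume "t \<in> space N"
        hence t: "0 \<le> t" using N(1) by auto
        show "norm (1 / (\<theta> k + t) * (t * \<phi> t * w t)) \<le> norm (1 / c * (t * \<phi> t * w t))"
          unfolding norm_mult using bd[OF t] c(1) by (intro mult_right_mono) auto
      qed
    qed
    have "0 \<le> H" unfolding H_def
      by (intro integral_nonneg_AE AE_I2 mult_nonneg_nonneg[OF bd(1) t_phi_w_nonneg] N_nonneg)
    moreover have "H \<le> (\<integral>t. 1 / c * (t * \<phi> t * w t) \<partial>N)"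
      unfolding H_def
      by (intro integral_mono int integrable_mult_right integrable_t_phi_w mult_right_mono bd(2) t_phi_w_nonneg N_nonneg)
    ultimately show ?thesis by (simp add: J_def)
  qed
  hence "\<beta> (Suc m) * cmod (W (m - 1) k) * \<bar>H\<bar> \<le> \<beta> (Suc m) * cmod (W (m - 1) k) * (J / c)"
    using beta_nonneg by (intro mult_left_mono) auto
  thus ?thesis unfolding eq by simp
qed

text \<open>
  Split the error into its projection \<open>p\<close> onto the Krylov space and the rest \<open>r\<close>. The rest has
  the same component along \<open>v (Suc m)\<close> as the error itself, and this component bounds all
  coefficients of \<open>p\<close>.
\<close>

theorem error_le_projection_residual:
  "nrm n E \<le> (1 + \<beta> (Suc m) / c) * nrm n (\<lambda>i. E i - (\<Sum>k<m. ip n E (y k) * y k i))"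
proof -
  define p where "p i = (\<Sum>k<m. ip n E (y k) * y k i)" for i
  define r where "r i = E i - p i" for i
  define B where "B = \<beta> (Suc m) / c"
  have B: "0 \<le> B" using beta_nonneg c(1) by (simp add: B_def)
  obtain C :: complex where C: "\<And>i. i < n \<Longrightarrow> E i = \<beta> (Suc m) * C * (v (Suc m) i * G i)" using E_eq by blast
  have ipE: "ip n E x = \<beta> (Suc m) * C * ip n (\<lambda>i. v (Suc m) i * G i) x" for x
    by (subst ip_cong[OF C refl]) (simp_all only: ip_scale_left)
  have coeff: "cmod (ip n E (y k)) \<le> B * cmod (ip n E (v (Suc m))) * cmod (W (m - 1) k)" if k: "k < m" for k
  proof -
    have "cmod (ip n E (y k)) \<le> cmod (\<beta> (Suc m) * C) * (B * cmod (W (m - 1) k) * J)"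
      unfolding ipE norm_mult[of "complex_of_real (\<beta> (Suc m)) * C"] B_def
      by (intro mult_left_mono ip_vG_y[OF k]) simp
    thus ?thesis unfolding ipE ip_vG_v using J_nonneg by (simp add: norm_mult mult_ac)
  qed
  have ipp: "ip n p (y k) = ip n E (y k)" if k: "k < m" for k
    unfolding p_def[abs_def] by (rule ip_ritz_sum[OF k])
  have r_y: "ip n r (y k) = 0" if "k < m" for k
    using ipp[OF that] by (simp add: r_def[abs_def] ip_diff_left)
  have r_p: "ip n r p = 0"
    unfolding p_def[abs_def] ip_sum_right ip_scale_right using r_y by simp
  have p2: "(nrm n p)\<^sup>2 = (\<Sum>k<m. (cmod (ip n E (y k)))\<^sup>2)"
  proof -
    have "complex_of_real ((nrm n p)\<^sup>2) = ip n p p" by (simp only: ip_self)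
    also have "\<dots> = (\<Sum>k<m. cnj (ip n E (y k)) * ip n p (y k))"
      by (subst (2) p_def[abs_def]) (simp only: ip_sum_right ip_scale_right)
    also have "\<dots> = complex_of_real (\<Sum>k<m. (cmod (ip n E (y k)))\<^sup>2)"
      unfolding of_real_sum complex_norm_square by (intro sum.cong refl) (simp add: ipp)
    finally show ?thesis by (simp only: of_real_eq_iff)
  qed
  have "ip n p (v (Suc m)) = 0"
    unfolding p_def[abs_def] ip_sum_left ip_scale_left
    using ip_commute[of n "y _" "v (Suc m)"] by (simp add: ip_v_Suc_y)
  hence rv: "ip n r (v (Suc m)) = ip n E (v (Suc m))" by (simp add: r_def[abs_def] ip_diff_left)
  have "nrm n (v (Suc m)) \<le> 1"
  proof (cases "\<beta> (Suc m) = 0")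
    case True
    thus ?thesis using v_zero[OF m] by (simp add: nrm_def L2_set_def)
  next
    case False
    thus ?thesis using v_unit[OF m] by (simp add: ip_self_eq_1_iff)
  qed
  hence Ev: "cmod (ip n E (v (Suc m))) \<le> nrm n r"
    using ip_le_nrm[of n r "v (Suc m)"] rv mult_left_mono[of "nrm n (v (Suc m))" 1 "nrm n r"] by simp
  have W1: "(\<Sum>k<m. (cmod (W (m - 1) k))\<^sup>2) = 1"
  proof -
    have "complex_of_real (\<Sum>k<m. (cmod (W (m - 1) k))\<^sup>2) = complex_of_real 1"
      unfolding of_real_sum complex_norm_square using W_rows[of "m - 1" "m - 1"] m by simp
    thus ?thesis by (simp only: of_real_eq_iff)
  qed
  have "(nrm n p)\<^sup>2 \<le> (\<Sum>k<m. (B * nrm n r * cmod (W (m - 1) k))\<^sup>2)"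
    unfolding p2
  proof (intro sum_mono power_mono)
    fix k assume "k \<in> {..<m}"
    hence "cmod (ip n E (y k)) \<le> B * cmod (ip n E (v (Suc m))) * cmod (W (m - 1) k)" using coeff by simp
    also have "\<dots> \<le> B * nrm n r * cmod (W (m - 1) k)"
      using Ev B by (intro mult_right_mono mult_left_mono) auto
    finally show "cmod (ip n E (y k)) \<le> B * nrm n r * cmod (W (m - 1) k)" .
  qed simp
  also have "\<dots> = (B * nrm n r)\<^sup>2"
    by (simp only: power_mult_distrib sum_distrib_left[symmetric] W1 mult_1_right)
  finally have p_le: "(nrm n p)\<^sup>2 \<le> (B * nrm n r)\<^sup>2" .
  have "(nrm n E)\<^sup>2 = (nrm n r)\<^sup>2 + (nrm n p)\<^sup>2"
    using nrm_orth_add[OF r_p] by (simp add: r_def)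
  also have "\<dots> \<le> ((1 + B) * nrm n r)\<^sup>2"
    using p_le mult_nonneg_nonneg[OF B zero_le_power2[of "nrm n r"]]
    by (simp add: power2_eq_square algebra_simps)
  finally have "nrm n E \<le> (1 + B) * nrm n r"
    by (rule power2_le_imp_le) (use B in simp)
  thus ?thesis unfolding B_def r_def p_def .
qed

text \<open>
  The Lanczos approximation lies in the Krylov space, so its error and the vector to be
  approximated have the same residual of projection.
\<close>

theorem near_optimal:
  "\<exists>q. degree q \<le> m - 1 \<and>
     (\<forall>p. degree p \<le> m - 1 \<longrightarrow>
        nrm n (\<lambda>i. f (l i) * v 1 i - poly q (complex_of_real (l i)) * v 1 i)
          \<le> nrm n (\<lambda>i. f (l i) * v 1 i - poly p (complex_of_real (l i)) * v 1 i)) \<and>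
     nrm n E \<le> (1 + \<beta> (Suc m) / c) * nrm n (\<lambda>i. f (l i) * v 1 i - poly q (complex_of_real (l i)) * v 1 i)"
proof -
  define F where "F i = f (l i) * v 1 i" for i
  obtain q where q: "degree q \<le> m - 1"
    "\<And>i. i < n \<Longrightarrow> poly q (complex_of_real (l i)) * v 1 i = (\<Sum>k<m. ip n F (y k) * y k i)"
    "\<And>p. degree p \<le> m - 1 \<Longrightarrow> nrm n (\<lambda>i. F i - poly q (complex_of_real (l i)) * v 1 i)
        \<le> nrm n (\<lambda>i. F i - poly p (complex_of_real (l i)) * v 1 i)"
    by (rule projection_is_best[of F]) blast
  define d where "d k = f (\<theta> k) * cnj (W 0 k)" for k
  have E: "E i = F i - (\<Sum>k<m. d k * y k i)" for i by (simp add: E_def F_def d_def)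
  have "ip n E (y k) = ip n F (y k) - d k" if "k < m" for k
    unfolding E[abs_def] ip_diff_left ip_ritz_sum[OF that] ..
  hence "(\<Sum>k<m. ip n E (y k) * y k i) = (\<Sum>k<m. ip n F (y k) * y k i) - (\<Sum>k<m. d k * y k i)" for i
    by (simp add: sum_subtractf left_diff_distrib)
  hence "E i - (\<Sum>k<m. ip n E (y k) * y k i) = F i - (\<Sum>k<m. ip n F (y k) * y k i)" for i
    using E[of i] by simp
  hence "nrm n (\<lambda>i. E i - (\<Sum>k<m. ip n E (y k) * y k i)) = nrm n (\<lambda>i. F i - poly q (complex_of_real (l i)) * v 1 i)"
    unfolding nrm_def using q(2) by (intro L2_set_cong) simp_all
  hence "nrm n E \<le> (1 + \<beta> (Suc m) / c) * nrm n (\<lambda>i. F i - poly q (complex_of_real (l i)) * v 1 i)"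
    using error_le_projection_residual by simp
  thus ?thesis using q(1,3) unfolding F_def by blast
qed

end

section \<open>Eigenvector coordinates of a Hermitian matrix\<close>

lemma mult_mat_vec_index:
  assumes "B \<in> carrier_mat r k" "x \<in> carrier_vec k" "s < r"
  shows "(B *\<^sub>v x) $ s = (\<Sum>t<k. B $$ (s, t) * x $ t)"
  using assms by (auto simp: scalar_prod_def lessThan_atLeast0 intro!: sum.cong)

lemma vec_eq_if_diff_0:
  fixes x y :: "complex vec"
  assumes "x \<in> carrier_vec n" "y \<in> carrier_vec n" "x - y = 0\<^sub>v n"
  shows "x = y"
proof (rule eq_vecI)
  fix i assume "i < dim_vec y"
  thus "x $ i = y $ i" using arg_cong[OF assms(3), of "\<lambda>v. v $ i"] assms(1,2) by simp
qed (use assms in simp)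

text \<open>
  All matrix functions of \<open>A\<close> are transported to coordinates with respect to the columns of \<open>U\<close>.
\<close>

locale unitary_diagonalization =
  fixes n :: nat and U :: "complex mat" and d :: "nat \<Rightarrow> real" and A :: "complex mat"
  assumes diag: "unitary_diag n U d A"
begin

lemma U: "U \<in> carrier_mat n n"
  and adjoint_U: "mat_adjoint U \<in> carrier_mat n n"
  and U_left: "mat_adjoint U * U = 1\<^sub>m n"
  and A_eq: "A = U * mat_diag n (\<lambda>i. complex_of_real (d i)) * mat_adjoint U"
  using diag mat_adjoint_carrier unfolding unitary_diag_def by blast+

lemma U_right: "U * mat_adjoint U = 1\<^sub>m n"
  by (rule mat_mult_left_right_inverse[OF adjoint_U U U_left])

lemma A: "A \<in> carrier_mat n n"
  unfolding A_eq using U adjoint_U by (intro mult_carrier_mat[of _ n n _ n]) auto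

lemma U_cols:
  assumes "i < n" "j < n"
  shows "(\<Sum>s<n. U $$ (s, i) * cnj (U $$ (s, j))) = (if i = j then 1 else 0)"
proof -
  have "(mat_adjoint U * U) $$ (j, i) = (\<Sum>s<n. U $$ (s, i) * cnj (U $$ (s, j)))"
    using assms U by (auto simp: scalar_prod_def index_mat_adjoint lessThan_atLeast0 mult.commute intro!: sum.cong)
  thus ?thesis using assms unfolding U_left by auto
qed

lemma U_rows:
  assumes "s < n" "t < n"
  shows "(\<Sum>i<n. U $$ (s, i) * cnj (U $$ (t, i))) = (if s = t then 1 else 0)"
proof -
  have "(U * mat_adjoint U) $$ (s, t) = (\<Sum>i<n. U $$ (s, i) * cnj (U $$ (t, i)))"
    using assms U by (auto simp: scalar_prod_def index_mat_adjoint lessThan_atLeast0 intro!: sum.cong)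
  thus ?thesis using assms unfolding U_right by auto
qed

lemma mat_fun_index:
  assumes "s < n" "t < n"
  shows "mat_fun f A $$ (s, t) = (\<Sum>k<n. U $$ (s, k) * f (d k) * cnj (U $$ (t, k)))"
proof -
  have "mat_fun f A = mat n n (\<lambda>(i, j). U $$ (i, j) * complex_of_real (f (d j))) * mat_adjoint U"
    unfolding mat_fun_eqI[OF diag] mat_diag_mult_right[OF U] ..
  thus ?thesis
    using assms U by (auto simp: scalar_prod_def index_mat_adjoint lessThan_atLeast0 intro!: sum.cong)
qed

lemma mat_fun_carrier: "mat_fun f A \<in> carrier_mat n n"
  unfolding mat_fun_eqI[OF diag] using U adjoint_U by (intro mult_carrier_mat[of _ n n _ n]) auto

lemma mat_fun_self: "mat_fun (\<lambda>x. x) A = A"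
  unfolding mat_fun_eqI[OF diag] using A_eq by simp

text \<open>
  The coordinates of \<open>x\<close> in the eigenbasis, that is the entries of \<open>U* x\<close>.
\<close>

definition co :: "complex vec \<Rightarrow> nat \<Rightarrow> complex" where
  "co x i = (\<Sum>s<n. cnj (U $$ (s, i)) * x $ s)"

lemma co_diff: "x \<in> carrier_vec n \<Longrightarrow> y \<in> carrier_vec n \<Longrightarrow> co (x - y) i = co x i - co y i"
  by (simp add: co_def sum_subtractf algebra_simps)

lemma co_smult: "x \<in> carrier_vec n \<Longrightarrow> co (c \<cdot>\<^sub>v x) i = c * co x i"
  by (simp add: co_def sum_distrib_left mult_ac)

lemma co_zero: "co (0\<^sub>v n) i = 0"
  by (simp add: co_def)

lemma ip_co: "ip n (co x) (co y) = ip n (($) x) (($) y)"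
proof -
  have "ip n (co x) (co y) = (\<Sum>i<n. \<Sum>s<n. \<Sum>t<n. x $ s * cnj (y $ t) * (U $$ (t, i) * cnj (U $$ (s, i))))"
    by (simp add: ip_def co_def sum_product mult_ac)
  also have "\<dots> = (\<Sum>s<n. \<Sum>i<n. \<Sum>t<n. x $ s * cnj (y $ t) * (U $$ (t, i) * cnj (U $$ (s, i))))"
    by (rule sum.swap)
  also have "\<dots> = (\<Sum>s<n. \<Sum>t<n. \<Sum>i<n. x $ s * cnj (y $ t) * (U $$ (t, i) * cnj (U $$ (s, i))))"
    by (intro sum.cong refl sum.swap)
  also have "\<dots> = (\<Sum>s<n. \<Sum>t<n. x $ s * cnj (y $ t) * (\<Sum>i<n. U $$ (t, i) * cnj (U $$ (s, i))))"
    by (simp only: sum_distrib_left)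
  also have "\<dots> = (\<Sum>s<n. \<Sum>t<n. if t = s then x $ s * cnj (y $ t) else 0)"
    by (intro sum.cong refl) (simp add: U_rows)
  also have "\<dots> = ip n (($) x) (($) y)" by (simp add: ip_def)
  finally show ?thesis .
qed

lemma vec_norm_co: "x \<in> carrier_vec n \<Longrightarrow> vec_norm x = nrm n (co x)"
proof -
  assume x: "x \<in> carrier_vec n"
  have "complex_of_real ((nrm n (co x))\<^sup>2) = complex_of_real ((nrm n (($) x))\<^sup>2)"
    unfolding ip_self[symmetric] by (rule ip_co)
  hence "nrm n (co x) = nrm n (($) x)" by (simp only: of_real_eq_iff) (simp add: power2_eq_iff_nonneg)
  thus ?thesis using x by (simp add: vec_norm_def nrm_def)
qed

lemma cscalar_co: "x \<in> carrier_vec n \<Longrightarrow> y \<in> carrier_vec n \<Longrightarrow> x \<bullet>c y = ip n (co x) (co y)"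
  unfolding ip_co by (auto simp: scalar_prod_def ip_def lessThan_atLeast0 intro!: sum.cong)

lemma co_eq_0D:
  assumes "x \<in> carrier_vec n" "\<And>i. i < n \<Longrightarrow> co x i = 0"
  shows "x = 0\<^sub>v n"
proof -
  have "x \<bullet>c x = 0" using assms by (simp add: cscalar_co ip_def)
  thus ?thesis using assms(1) by simp
qed

lemma co_mat_fun:
  assumes x: "x \<in> carrier_vec n" and i: "i < n"
  shows "co (mat_fun f A *\<^sub>v x) i = f (d i) * co x i"
proof -
  have "(mat_fun f A *\<^sub>v x) $ s = (\<Sum>k<n. U $$ (s, k) * (f (d k) * co x k))" if s: "s < n" for s
  proof -
    have "(mat_fun f A *\<^sub>v x) $ s = (\<Sum>t<n. mat_fun f A $$ (s, t) * x $ t)"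
      by (rule mult_mat_vec_index[OF mat_fun_carrier x s])
    also have "\<dots> = (\<Sum>t<n. \<Sum>k<n. U $$ (s, k) * (f (d k) * (cnj (U $$ (t, k)) * x $ t)))"
      using s by (simp add: mat_fun_index sum_distrib_right mult.assoc)
    also have "\<dots> = (\<Sum>k<n. U $$ (s, k) * (f (d k) * co x k))"
      by (subst sum.swap) (simp add: co_def sum_distrib_left)
    finally show ?thesis .
  qed
  hence "co (mat_fun f A *\<^sub>v x) i = (\<Sum>s<n. \<Sum>k<n. (f (d k) * co x k) * (U $$ (s, k) * cnj (U $$ (s, i))))"
    by (simp add: co_def[of "mat_fun f A *\<^sub>v x"] sum_distrib_left mult_ac)
  also have "\<dots> = (\<Sum>k<n. (f (d k) * co x k) * (\<Sum>s<n. U $$ (s, k) * cnj (U $$ (s, i))))"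
    by (subst sum.swap) (simp add: sum_distrib_left)
  also have "\<dots> = (\<Sum>k<n. if k = i then f (d k) * co x k else 0)"
    using i by (intro sum.cong refl) (simp add: U_cols)
  finally show ?thesis using i by simp
qed

lemma co_A: "x \<in> carrier_vec n \<Longrightarrow> i < n \<Longrightarrow> co (A *\<^sub>v x) i = d i * co x i"
  using co_mat_fun[of x i "\<lambda>x. x"] by (simp add: mat_fun_self)

lemma co_pow: "x \<in> carrier_vec n \<Longrightarrow> i < n \<Longrightarrow> co (A ^\<^sub>m k *\<^sub>v x) i = complex_of_real (d i) ^ k * co x i"
proof (induction k arbitrary: x)
  case 0
  thus ?case using A by simp
next
  case (Suc k)
  have "A ^\<^sub>m Suc k *\<^sub>v x = A ^\<^sub>m k *\<^sub>v (A *\<^sub>v x)"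
    using A Suc.prems by (simp add: assoc_mult_mat_vec[of _ n n _ n])
  moreover have "A *\<^sub>v x \<in> carrier_vec n" using A Suc.prems by simp
  ultimately show ?case using Suc by (simp add: co_A)
qed

lemma co_mat_poly:
  assumes x: "x \<in> carrier_vec n" and i: "i < n"
  shows "co (mat_poly p A *\<^sub>v x) i = poly p (complex_of_real (d i)) * co x i"
proof -
  have dim: "dim_row A = n" using A by simp
  have "(mat_poly p A *\<^sub>v x) $ s = (\<Sum>k\<le>degree p. coeff p k * (A ^\<^sub>m k *\<^sub>v x) $ s)" if s: "s < n" for s
  proof -
    have "(mat_poly p A *\<^sub>v x) $ s = (\<Sum>t<n. (\<Sum>k\<le>degree p. coeff p k * (A ^\<^sub>m k) $$ (s, t)) * x $ t)"
      using s x dim by (auto simp: mat_poly_def scalar_prod_def lessThan_atLeast0 intro!: sum.cong)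
    also have "\<dots> = (\<Sum>k\<le>degree p. coeff p k * (\<Sum>t<n. (A ^\<^sub>m k) $$ (s, t) * x $ t))"
      unfolding sum_distrib_right sum_distrib_left by (subst sum.swap) (simp add: mult.assoc)
    also have "\<dots> = (\<Sum>k\<le>degree p. coeff p k * (A ^\<^sub>m k *\<^sub>v x) $ s)"
      by (simp only: mult_mat_vec_index[OF pow_carrier_mat[OF A] x s])
    finally show ?thesis .
  qed
  hence "co (mat_poly p A *\<^sub>v x) i = (\<Sum>k\<le>degree p. coeff p k * co (A ^\<^sub>m k *\<^sub>v x) i)"
    unfolding co_def sum_distrib_left by (subst sum.swap) (simp add: sum_distrib_left mult_ac)
  also have "\<dots> = poly p (complex_of_real (d i)) * co x i"
    using x i by (simp add: co_pow poly_altdef sum_distrib_right mult.assoc)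
  finally show ?thesis .
qed

lemma mat_poly_carrier: "mat_poly p A \<in> carrier_mat n n"
  using A by (simp add: mat_poly_def)

lemma eigenvector_col:
  assumes i: "i < n"
  shows "eigenvector A (col U i) (complex_of_real (d i))" and "vec_norm (col U i) = 1"
proof -
  have c: "col U i \<in> carrier_vec n" using U i by simp
  have co_col: "co (col U i) j = (if j = i then 1 else 0)" if "j < n" for j
    using U_cols[OF i that] U i that by (auto simp: co_def mult.commute)
  have "A *\<^sub>v col U i - complex_of_real (d i) \<cdot>\<^sub>v col U i = 0\<^sub>v n"
    using A c by (intro co_eq_0D) (simp_all add: co_diff co_A co_smult co_col)
  moreover have "A *\<^sub>v col U i \<in> carrier_vec n" "complex_of_real (d i) \<cdot>\<^sub>v col U i \<in> carrier_vec n"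
    using A c by simp_all
  ultimately have *: "A *\<^sub>v col U i = complex_of_real (d i) \<cdot>\<^sub>v col U i"
    by (rule vec_eq_if_diff_0[rotated 2])
  have "co (col U i) i \<noteq> co (0\<^sub>v n) i" using co_col[OF i] by (simp add: co_zero)
  hence "col U i \<noteq> 0\<^sub>v n" by metis
  thus "eigenvector A (col U i) (complex_of_real (d i))"
    unfolding eigenvector_def carrier_matD(1)[OF A] using c * by blast
  have "ip n (co (col U i)) (co (col U i)) = (\<Sum>j<n. if j = i then 1 else 0)"
    unfolding ip_def by (intro sum.cong refl) (simp add: co_col)
  hence "ip n (co (col U i)) (co (col U i)) = 1" using i by simp
  thus "vec_norm (col U i) = 1" using c by (simp add: vec_norm_co ip_self_eq_1_iff)
qed

lemma real_eigenvalues: "{x. eigenvalue A (complex_of_real x)} = d ` {..<n}"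
proof (intro equalityI subsetI)
  fix x assume "x \<in> {x. eigenvalue A (complex_of_real x)}"
  then obtain u where u: "u \<in> carrier_vec n" "u \<noteq> 0\<^sub>v n" and Au: "A *\<^sub>v u = complex_of_real x \<cdot>\<^sub>v u"
    using A by (auto simp: eigenvalue_def eigenvector_def)
  obtain i where i: "i < n" "co u i \<noteq> 0" using co_eq_0D[OF u(1)] u(2) by blast
  have "d i * co u i = x * co u i" using arg_cong[OF Au, of "\<lambda>v. co v i"] u(1) i(1) by (simp add: co_A co_smult)
  thus "x \<in> d ` {..<n}" using i by auto
qed (use eigenvector_col(1) in \<open>auto simp: eigenvalue_def\<close>)

lemma lambda_min_le: "i < n \<Longrightarrow> lambda_min A \<le> d i"
  and lambda_max_ge: "i < n \<Longrightarrow> d i \<le> lambda_max A"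
  unfolding lambda_min_def lambda_max_def real_eigenvalues by simp_all

lemma d_pos:
  assumes "hermitian_pos_def A" "i < n"
  shows "0 < d i"
proof -
  note ev = eigenvector_col[OF assms(2)]
  have c: "col U i \<in> carrier_vec n" using U assms by simp
  have "0 < Re ((A *\<^sub>v col U i) \<bullet>c col U i)"
    using assms(1) ev(1) unfolding hermitian_pos_def_def eigenvector_def carrier_matD(1)[OF A] by blast
  also have "(A *\<^sub>v col U i) \<bullet>c col U i = d i * (col U i \<bullet>c col U i)"
    using ev(1) c by (simp add: eigenvector_def)
  also have "col U i \<bullet>c col U i = 1"
    using ev(2) c by (simp add: cscalar_co ip_self_eq_1_iff vec_norm_co)
  finally show ?thesis by simp
qed

lemma lambda_min_pos:
  assumes "hermitian_pos_def A" "0 < n"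
  shows "0 < lambda_min A"
proof -
  have "lambda_min A \<in> d ` {..<n}"
    unfolding lambda_min_def real_eigenvalues using assms(2) by (intro Min_in) auto
  thus ?thesis using d_pos[OF assms(1)] by auto
qed

end

section \<open>The Lanczos method in eigenvector coordinates\<close>

lemma lanczos_vec_dims:
  assumes "A \<in> carrier_mat n n" "b \<in> carrier_vec n"
  shows "lanczos_v A b j \<in> carrier_vec n" "lanczos_w A b j \<in> carrier_vec n"
proof -
  have "lanczos_v A b j \<in> carrier_vec n \<and> lanczos_w A b j \<in> carrier_vec n"
  proof (induction j rule: less_induct)
    case (less j)
    have v: "lanczos_v A b j \<in> carrier_vec n"
    proof -
      consider "j = 0" | "j = 1" | k where "j = Suc (Suc k)" by (metis One_nat_def not0_implies_Suc)
      thus ?thesis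
      proof cases
        case (3 k)
        hence "lanczos_w A b (Suc k) \<in> carrier_vec n" using less.IH[of "Suc k"] by blast
        thus ?thesis unfolding 3 lanczos_v.simps by simp
      qed (use assms in auto)
    qed
    moreover have "lanczos_w A b j \<in> carrier_vec n"
    proof (cases j)
      case 0
      thus ?thesis using assms by simp
    next
      case (Suc k)
      hence "lanczos_v A b k \<in> carrier_vec n" using less.IH[of k] by blast
      thus ?thesis using v unfolding Suc lanczos_w.simps Let_def
        by (intro minus_carrier_vec smult_carrier_vec[THEN iffD2] mult_mat_vec_carrier[OF assms(1)])
    qed
    ultimately show ?case ..
  qed
  thus "lanczos_v A b j \<in> carrier_vec n" "lanczos_w A b j \<in> carrier_vec n" by auto
qed

text \<open>
  As simplification rules these equations would unroll the whole Lanczos recursion.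
\<close>

declare lanczos_v.simps(3) [simp del] lanczos_w.simps(2) [simp del] lanczos_beta.simps(3) [simp del]

locale lanczos_diagonalization = unitary_diagonalization +
  fixes b :: "complex vec"
  assumes b: "b \<in> carrier_vec n" and norm_b: "vec_norm b = 1"
begin

abbreviation cv :: "nat \<Rightarrow> nat \<Rightarrow> complex" where
  "cv j \<equiv> co (lanczos_v A b j)"

definition \<alpha> :: "nat \<Rightarrow> complex" where
  "\<alpha> j = ip n (\<lambda>i. d i * cv j i - lanczos_beta A b j * cv (j - 1) i) (cv j)"

lemmas lanczos_carrier [simp] = lanczos_vec_dims[OF A b]

lemma co_lanczos_w:
  assumes i: "i < n"
  shows "co (lanczos_w A b (Suc j)) i =
    d i * cv (Suc j) i - lanczos_beta A b (Suc j) * cv j i - \<alpha> (Suc j) * cv (Suc j) i"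
proof -
  let ?w = "A *\<^sub>v lanczos_v A b (Suc j) - complex_of_real (lanczos_beta A b (Suc j)) \<cdot>\<^sub>v lanczos_v A b j"
  have Av: "A *\<^sub>v lanczos_v A b (Suc j) \<in> carrier_vec n" by (rule mult_mat_vec_carrier[OF A lanczos_carrier(1)])
  hence w: "?w \<in> carrier_vec n" by (intro minus_carrier_vec smult_carrier_vec[THEN iffD2] lanczos_carrier(1))
  have co_w: "co ?w i = d i * cv (Suc j) i - lanczos_beta A b (Suc j) * cv j i" if "i < n" for i
    using Av that by (simp add: co_diff co_smult co_A)
  have "?w \<bullet>c lanczos_v A b (Suc j) = \<alpha> (Suc j)"
    unfolding cscalar_co[OF w lanczos_carrier(1)] \<alpha>_def by (rule ip_cong) (simp_all add: co_w)
  hence "lanczos_w A b (Suc j) = ?w - \<alpha> (Suc j) \<cdot>\<^sub>v lanczos_v A b (Suc j)"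
    by (simp only: lanczos_w.simps Let_def)
  hence "co (lanczos_w A b (Suc j)) i = co ?w i - co (\<alpha> (Suc j) \<cdot>\<^sub>v lanczos_v A b (Suc j)) i"
    using w by (simp only: co_diff smult_carrier_vec lanczos_carrier(1))
  thus ?thesis using co_w[OF i] by (simp only: co_smult[OF lanczos_carrier(1)])
qed

lemma cv_Suc_Suc: "cv (Suc (Suc j)) i = co (lanczos_w A b (Suc j)) i / lanczos_beta A b (Suc (Suc j))"
  by (simp only: lanczos_v.simps co_smult[OF lanczos_carrier(2)]) simp

lemma beta_Suc_Suc: "lanczos_beta A b (Suc (Suc j)) = nrm n (co (lanczos_w A b (Suc j)))"
  by (simp only: lanczos_beta.simps vec_norm_co[OF lanczos_carrier(2)])

lemma lanczos_beta_nonneg: "0 \<le> lanczos_beta A b (Suc (Suc j))"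
  unfolding beta_Suc_Suc by simp

lemma co_w_eq_0:
  assumes "lanczos_beta A b (Suc (Suc j)) = 0" "i < n"
  shows "co (lanczos_w A b (Suc j)) i = 0"
  using assms unfolding beta_Suc_Suc nrm_def by (simp add: L2_set_eq_0_iff)

text \<open>
  A breakdown gives \<open>v\<^sub>j\<^sub>+\<^sub>1 = 0\<close> because \<open>1 / 0 = 0\<close>, and then \<open>w\<^sub>j = 0\<close> as well, so that
  \<open>w\<^sub>j = \<beta>\<^sub>j\<^sub>+\<^sub>1 v\<^sub>j\<^sub>+\<^sub>1\<close> holds in either case.
\<close>

lemma lanczos_recurrence_cv:
  assumes "1 \<le> m" and nz: "\<And>j. 1 \<le> j \<Longrightarrow> j < m \<Longrightarrow> lanczos_beta A b (Suc j) \<noteq> 0"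
  shows "lanczos_recurrence n m d cv \<alpha> (lanczos_beta A b)"
proof (unfold_locales)
  show "cv 0 i = 0" for i using b by (simp add: co_zero)
  show "ip n (cv 1) (cv 1) = 1" using norm_b b by (simp add: ip_self_eq_1_iff vec_norm_co)
  fix j :: nat assume "1 \<le> j"
  then obtain k where k: "j = Suc k" by (cases j) auto
  show "\<alpha> j = ip n (\<lambda>i. d i * cv j i - lanczos_beta A b j * cv (j - 1) i) (cv j)"
    by (rule \<alpha>_def)
  show "lanczos_beta A b (Suc j) \<noteq> 0" if "j < m" using nz \<open>1 \<le> j\<close> that .
  show "d i * cv j i = lanczos_beta A b (Suc j) * cv (Suc j) i + \<alpha> j * cv j i + lanczos_beta A b j * cv (j - 1) i"
    if i: "i < n" for i
  proof -
    have "lanczos_beta A b (Suc j) * cv (Suc j) i = co (lanczos_w A b j) i"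
      unfolding k cv_Suc_Suc using co_w_eq_0[OF _ i, of k] by (cases "lanczos_beta A b (Suc (Suc k)) = 0") simp_all
    thus ?thesis using co_lanczos_w[OF i, of k] unfolding k by simp
  qed
  show "cv (Suc j) i = 0" if "lanczos_beta A b (Suc j) = 0" for i
    using that unfolding k cv_Suc_Suc by simp
  show "ip n (cv (Suc j)) (cv (Suc j)) = 1" if "lanczos_beta A b (Suc j) \<noteq> 0"
  proof -
    let ?\<beta> = "lanczos_beta A b (Suc (Suc k))"
    have "cv (Suc j) = (\<lambda>i. complex_of_real (1 / ?\<beta>) * co (lanczos_w A b j) i)"
      unfolding k by (rule ext) (simp add: cv_Suc_Suc)
    hence "ip n (cv (Suc j)) (cv (Suc j)) = complex_of_real (1 / ?\<beta> * (1 / ?\<beta>) * ?\<beta>\<^sup>2)"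
      unfolding k by (simp only: ip_scale_left ip_scale_right ip_self beta_Suc_Suc[symmetric]) simp
    also have "1 / ?\<beta> * (1 / ?\<beta>) * ?\<beta>\<^sup>2 = 1"
      using that unfolding k by (simp add: power2_eq_square)
    finally show ?thesis by simp
  qed
qed (use assms in simp)

text \<open>
  Linear combinations in the sense of \<open>span\<close> range over sets of vectors. The family \<open>u\<close> may have
  repetitions, hence the induction on its length.
\<close>

lemma in_span_if_co_combination:
  fixes S and r :: nat
  defines "sp \<equiv> LinearCombinations.module.span class_ring (module_vec TYPE(complex) n)"
  assumes S: "S \<subseteq> carrier_vec n" and x: "x \<in> carrier_vec n"
    and u: "\<And>t. t < r \<Longrightarrow> u t \<in> S"
    and co_x: "\<And>i. i < n \<Longrightarrow> co x i = (\<Sum>t<r. a t * co (u t) i)"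
  shows "x \<in> sp S"
  using x u co_x
proof (induction r arbitrary: x)
  interpret vec_space "TYPE(complex)" n .
  case 0
  hence "x = 0\<^sub>v n" by (intro co_eq_0D) auto
  thus ?case unfolding sp_def using span_zero by simp
next
  interpret vec_space "TYPE(complex)" n .
  case (Suc r)
  let ?y = "x - a r \<cdot>\<^sub>v u r"
  have ur: "u r \<in> carrier_vec n" "u r \<in> S" using S Suc.prems(2) by auto
  have y: "?y \<in> carrier_vec n" using ur Suc.prems(1) by simp
  have ysp: "?y \<in> span S"
    unfolding sp_def[symmetric]
  proof (rule Suc.IH[OF y])
    show "u t \<in> S" if "t < r" for t using Suc.prems(2) that by simp
    show "co ?y i = (\<Sum>t<r. a t * co (u t) i)" if "i < n" for i
      using Suc.prems(1,3) that ur by (simp add: co_diff co_smult)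
  qed
  have usp: "a r \<cdot>\<^sub>v u r \<in> span S"
    using S smult_in_span[OF S, of "u r"] in_own_span[of S] ur(2) by auto
  have "x = ?y + a r \<cdot>\<^sub>v u r" using ur Suc.prems(1) by (intro eq_vecI) auto
  thus ?case unfolding sp_def using span_add1[OF S ysp usp] by simp
qed

text \<open>
  An annihilating polynomial of degree \<open>r\<close>, multiplied by a power of the variable, expresses
  \<open>A^k b\<close> by the \<open>r\<close> preceding powers.
\<close>

lemma krylov_Suc_eq:
  assumes p: "degree p = r" "p \<noteq> 0" "\<And>i. i < n \<Longrightarrow> poly p (complex_of_real (d i)) * co b i = 0"
    and k: "r \<le> k"
  shows "krylov A b (k + 1) = krylov A b k"
proof -
  interpret vec_space "TYPE(complex)" n .
  let ?S = "\<lambda>k. {(A ^\<^sub>m j) *\<^sub>v b | j. j < k}"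
  have carrier: "A ^\<^sub>m j *\<^sub>v b \<in> carrier_vec n" for j
    using pow_carrier_mat[OF A] b by (rule mult_mat_vec_carrier)
  hence S: "?S k \<subseteq> carrier_vec n" by auto
  have lc: "coeff p r \<noteq> 0" using p(1,2) by auto
  have "A ^\<^sub>m k *\<^sub>v b \<in> span (?S k)"
  proof (rule in_span_if_co_combination[OF S carrier])
    show "A ^\<^sub>m (k - r + t) *\<^sub>v b \<in> ?S k" if "t < r" for t using that k by auto
    fix i assume i: "i < n"
    let ?z = "complex_of_real (d i)"
    have "0 = ?z ^ (k - r) * (poly p ?z * co b i)" using p(3)[OF i] by simp
    also have "\<dots> = (\<Sum>t\<le>r. coeff p t * (?z ^ (k - r + t) * co b i))"
      by (simp add: poly_altdef p(1) sum_distrib_left sum_distrib_right power_add mult_ac)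
    also have "\<dots> = (\<Sum>t<r. coeff p t * (?z ^ (k - r + t) * co b i)) + coeff p r * (?z ^ k * co b i)"
      using k by (simp add: lessThan_Suc_atMost[symmetric])
    finally have "coeff p r * (?z ^ k * co b i) = (\<Sum>t<r. - (coeff p t * (?z ^ (k - r + t) * co b i)))"
      by (simp add: sum_negf eq_neg_iff_add_eq_0 add.commute)
    hence "?z ^ k * co b i = (\<Sum>t<r. - (coeff p t * (?z ^ (k - r + t) * co b i))) / coeff p r"
      using lc by (simp add: field_simps)
    also have "\<dots> = (\<Sum>t<r. - coeff p t / coeff p r * (?z ^ (k - r + t) * co b i))"
      by (simp add: sum_divide_distrib)
    finally show "co (A ^\<^sub>m k *\<^sub>v b) i = (\<Sum>t<r. - coeff p t / coeff p r * co (A ^\<^sub>m (k - r + t) *\<^sub>v b) i)"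
      by (simp only: co_pow[OF b i])
  qed
  hence "span (?S k) = span (?S k \<union> {A ^\<^sub>m k *\<^sub>v b})" by (intro already_in_span S) simp_all
  also have "?S k \<union> {A ^\<^sub>m k *\<^sub>v b} = ?S (k + 1)" by (auto simp: less_Suc_eq)
  finally show ?thesis using b unfolding krylov_def by simp
qed

text \<open>
  At the first breakdown, step \<open>r\<close>, the vector \<open>w\<^sub>r = 0\<close> is a polynomial of degree \<open>r\<close> in \<open>A\<close>
  applied to \<open>b\<close>. So the Krylov spaces are constant from \<open>r\<close> on.
\<close>

lemma lanczos_beta_nonzero:
  assumes "m \<le> invariance_index A b" "1 \<le> j" "j < m"
  shows "lanczos_beta A b (Suc j) \<noteq> 0"
proof
  assume "lanczos_beta A b (Suc j) = 0"
  \<comment> \<open>The first breakdown, so that the recurrence is regular up to there.\<close>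
  define r where "r = (LEAST j. 1 \<le> j \<and> lanczos_beta A b (Suc j) = 0)"
  have r: "1 \<le> r" "lanczos_beta A b (Suc r) = 0" "r \<le> j"
    using LeastI[of "\<lambda>j. 1 \<le> j \<and> lanczos_beta A b (Suc j) = 0" j]
      Least_le[of "\<lambda>j. 1 \<le> j \<and> lanczos_beta A b (Suc j) = 0" j] assms(2) \<open>lanczos_beta A b (Suc j) = 0\<close>
    by (auto simp: r_def)
  have "lanczos_beta A b (Suc i) \<noteq> 0" if "1 \<le> i" "i < r" for i
    using not_less_Least[of i "\<lambda>j. 1 \<le> j \<and> lanczos_beta A b (Suc j) = 0"] that unfolding r_def by blast
  then interpret lanczos_recurrence n r d cv \<alpha> "lanczos_beta A b"
    using lanczos_recurrence_cv r(1) by blast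
  obtain p where p: "degree p = r"
    "\<And>i. i < n \<Longrightarrow> lanczos_beta A b (Suc r) * cv (Suc r) i = poly p (complex_of_real (d i)) * cv 1 i"
    using lanczos_residual_poly by metis
  have "poly p (complex_of_real (d i)) * co b i = 0" if "i < n" for i
    using p(2)[OF that] r(2) by simp
  moreover have "p \<noteq> 0" using p(1) r(1) by auto
  ultimately have "krylov A b (k + 1) = krylov A b k" if "r \<le> k" for k
    using krylov_Suc_eq[OF p(1)] that by blast
  hence "invariance_index A b \<le> r" unfolding invariance_index_def by (intro Least_le) blast
  thus False using assms r(3) by simp
qed

lemma lanczos_V_carrier: "lanczos_V A b m \<in> carrier_mat n m"
  using b mat_of_cols_carrier(1)[of n "map (lanczos_v A b) [1..<m + 1]"]
  by (simp add: lanczos_V_def del: upt_Suc)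

lemma lanczos_V_index: "s < n \<Longrightarrow> p < m \<Longrightarrow> lanczos_V A b m $$ (s, p) = lanczos_v A b (Suc p) $ s"
  using b by (simp add: lanczos_V_def mat_of_cols_index del: upt_Suc)

lemma co_lanczos_V:
  assumes z: "z \<in> carrier_vec m"
  shows "co (lanczos_V A b m *\<^sub>v z) i = (\<Sum>p<m. z $ p * cv (Suc p) i)"
proof -
  have "co (lanczos_V A b m *\<^sub>v z) i =
    (\<Sum>s<n. cnj (U $$ (s, i)) * (\<Sum>p<m. lanczos_v A b (Suc p) $ s * z $ p))"
    unfolding co_def
    by (intro sum.cong refl) (simp add: mult_mat_vec_index[OF lanczos_V_carrier z] lanczos_V_index)
  also have "\<dots> = (\<Sum>p<m. z $ p * cv (Suc p) i)"
    unfolding co_def sum_distrib_left by (subst sum.swap) (simp add: mult_ac)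
  finally show ?thesis .
qed

lemma lanczos_T_carrier: "lanczos_T A b m \<in> carrier_mat m m"
  unfolding lanczos_T_def
  by (intro mult_carrier_mat[of _ m n] A mat_adjoint_carrier lanczos_V_carrier)

text \<open>
  This identifies the matrix of the Lanczos method with the abstract \<open>T\<close> of the recurrence.
\<close>

lemma lanczos_T_index:
  assumes p: "p < m" and q: "q < m"
  shows "lanczos_T A b m $$ (p, q) = ip n (\<lambda>i. d i * cv (Suc q) i) (cv (Suc p))"
proof -
  let ?V = "lanczos_V A b m"
  note V = lanczos_V_carrier[of m]
  note AV = mult_carrier_mat[OF A V]
  have dim: "dim_vec (lanczos_v A b (Suc q)) = n" by (rule carrier_vecD[OF lanczos_carrier(1)])
  have col: "col ?V q = lanczos_v A b (Suc q)"
  proof (rule eq_vecI)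
    show "dim_vec (col ?V q) = dim_vec (lanczos_v A b (Suc q))" unfolding dim using V by simp
    show "col ?V q $ s = lanczos_v A b (Suc q) $ s" if "s < dim_vec (lanczos_v A b (Suc q))" for s
      using that V q unfolding dim by (simp add: lanczos_V_index)
  qed
  have "lanczos_T A b m = mat_adjoint ?V * (A * ?V)"
    unfolding lanczos_T_def by (rule assoc_mult_mat[OF mat_adjoint_carrier[OF V] A V])
  hence "lanczos_T A b m $$ (p, q) = (\<Sum>s<n. cnj (?V $$ (s, p)) * (A * ?V) $$ (s, q))"
    by (simp only: adjoint_mult_index[OF V AV p q])
  also have "\<dots> = (\<Sum>s<n. (A *\<^sub>v lanczos_v A b (Suc q)) $ s * cnj (lanczos_v A b (Suc p) $ s))"
  proof (intro sum.cong refl)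
    fix s assume "s \<in> {..<n}"
    hence s: "s < n" by simp
    have "(A * ?V) $$ (s, q) = col (A * ?V) q $ s"
      by (rule index_col[symmetric]) (simp_all only: carrier_matD[OF AV] s q)
    also have "\<dots> = (A *\<^sub>v lanczos_v A b (Suc q)) $ s" by (simp only: col_mult2[OF A V q] col)
    finally show "cnj (?V $$ (s, p)) * (A * ?V) $$ (s, q) =
        (A *\<^sub>v lanczos_v A b (Suc q)) $ s * cnj (lanczos_v A b (Suc p) $ s)"
      using s p by (simp only: lanczos_V_index mult.commute)
  qed
  also have "\<dots> = ip n (co (A *\<^sub>v lanczos_v A b (Suc q))) (cv (Suc p))"
    unfolding ip_co by (simp only: ip_def)
  also have "\<dots> = ip n (\<lambda>i. d i * cv (Suc q) i) (cv (Suc p))"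
    by (intro ip_cong) (simp_all add: co_A)
  finally show ?thesis .
qed

lemma lanczos_T_hermitian: "mat_adjoint (lanczos_T A b m) = lanczos_T A b m"
proof (rule eq_matI)
  note T = lanczos_T_carrier[of m]
  fix p q assume "p < dim_row (lanczos_T A b m)" "q < dim_col (lanczos_T A b m)"
  hence pq: "p < m" "q < m" using T by auto
  have "mat_adjoint (lanczos_T A b m) $$ (p, q) = cnj (lanczos_T A b m $$ (q, p))"
    using pq T by (simp add: index_mat_adjoint)
  also have "\<dots> = ip n (cv (Suc q)) (\<lambda>i. d i * cv (Suc p) i)"
    unfolding lanczos_T_index[OF pq(2,1)] by (rule ip_commute[symmetric])
  also have "\<dots> = lanczos_T A b m $$ (p, q)"
    unfolding lanczos_T_index[OF pq] by (rule ip_mult_real[symmetric])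
  finally show "mat_adjoint (lanczos_T A b m) $$ (p, q) = lanczos_T A b m $$ (p, q)" .
qed (use lanczos_T_carrier[of m] in simp_all)

lemma lanczos_ritz_exists:
  assumes m: "1 \<le> m" "m \<le> invariance_index A b"
  obtains W \<theta> where "lanczos_ritz n m d cv \<alpha> (lanczos_beta A b) W \<theta>"
    "\<And>f. lanczos_approx f A b m \<in> carrier_vec n"
    "\<And>f i. co (lanczos_approx f A b m) i =
       (\<Sum>k<m. f (\<theta> k) * cnj (W 0 k) * (\<Sum>p<m. W p k * cv (Suc p) i))"
proof -
  obtain X \<theta> where X: "unitary_diag m X \<theta> (lanczos_T A b m)"
    using hermitian_unitary_diag[OF lanczos_T_carrier lanczos_T_hermitian] by blast
  interpret X: unitary_diagonalization m X \<theta> "lanczos_T A b m" by unfold_locales (rule X)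
  interpret lanczos_recurrence n m d cv \<alpha> "lanczos_beta A b"
    using lanczos_recurrence_cv[OF m(1)] lanczos_beta_nonzero[OF m(2)] by blast
  define W where "W p k = X $$ (p, k)" for p k
  have "lanczos_ritz n m d cv \<alpha> (lanczos_beta A b) W \<theta>"
  proof unfold_locales
    show "(\<Sum>p<m. W p k * cnj (W p k')) = (if k = k' then 1 else 0)" if "k < m" "k' < m" for k k'
      unfolding W_def by (rule X.U_cols[OF that])
    show "(\<Sum>k<m. W p k * cnj (W q k)) = (if p = q then 1 else 0)" if "p < m" "q < m" for p q
      unfolding W_def by (rule X.U_rows[OF that])
    show "(\<Sum>q<m. T p q * W q k) = \<theta> k * W p k" if pk: "p < m" "k < m" for p k
    proof -
      have c: "col X k \<in> carrier_vec m" using X.U pk by simp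
      have "(lanczos_T A b m *\<^sub>v col X k) $ p = (complex_of_real (\<theta> k) \<cdot>\<^sub>v col X k) $ p"
        using X.eigenvector_col(1)[OF pk(2)] by (simp only: eigenvector_def)
      thus ?thesis
        unfolding mult_mat_vec_index[OF lanczos_T_carrier c pk(1)]
        using X.U pk by (simp add: lanczos_T_index W_def)
    qed
  qed
  moreover have "co (lanczos_approx f A b m) i =
       (\<Sum>k<m. f (\<theta> k) * cnj (W 0 k) * (\<Sum>p<m. W p k * cv (Suc p) i))" for f i
  proof -
    let ?z = "mat_fun f (lanczos_T A b m) *\<^sub>v unit_vec m 0"
    have z: "?z \<in> carrier_vec m" using X.mat_fun_carrier by (rule mult_mat_vec_carrier) simp
    have zp: "?z $ p = (\<Sum>k<m. W p k * f (\<theta> k) * cnj (W 0 k))" if p: "p < m" for p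
    proof -
      have "?z $ p = (\<Sum>t<m. if t = 0 then mat_fun f (lanczos_T A b m) $$ (p, t) else 0)"
        unfolding mult_mat_vec_index[OF X.mat_fun_carrier unit_vec_carrier p]
        by (intro sum.cong refl) simp
      also have "\<dots> = mat_fun f (lanczos_T A b m) $$ (p, 0)" using m by simp
      also have "\<dots> = (\<Sum>k<m. W p k * f (\<theta> k) * cnj (W 0 k))"
        using p m by (simp add: X.mat_fun_index W_def)
      finally show ?thesis .
    qed
    have "co (lanczos_approx f A b m) i = (\<Sum>p<m. (\<Sum>k<m. W p k * f (\<theta> k) * cnj (W 0 k)) * cv (Suc p) i)"
      unfolding lanczos_approx_def co_lanczos_V[OF z] by (intro sum.cong refl) (simp only: lessThan_iff zp)
    also have "\<dots> = (\<Sum>k<m. f (\<theta> k) * cnj (W 0 k) * (\<Sum>p<m. W p k * cv (Suc p) i))"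
      unfolding sum_distrib_left sum_distrib_right by (subst sum.swap) (simp add: mult_ac)
    finally show ?thesis .
  qed
  moreover have "lanczos_approx f A b m \<in> carrier_vec n" for f
    unfolding lanczos_approx_def
    by (rule mult_mat_vec_carrier[OF lanczos_V_carrier mult_mat_vec_carrier[OF X.mat_fun_carrier unit_vec_carrier]])
  ultimately show ?thesis by (intro that)
qed

lemma n_pos: "0 < n"
proof (rule ccontr)
  assume "\<not> 0 < n"
  hence "vec_norm b = 0" using b by (simp add: vec_norm_def)
  thus False using norm_b by simp
qed

text \<open>
  The two constants of the theorem dominate the sharper constant \<open>1 + \<beta> / \<lambda>\<^sub>m\<^sub>i\<^sub>n\<close>.
\<close>

lemma near_optimal_constant_mono:
  assumes pd: "hermitian_pos_def A" and \<beta>: "0 \<le> \<beta>" "\<beta> \<le> lambda_max A"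
  shows "1 + \<beta> / lambda_min A \<le> 1 + \<beta> * (lambda_max A / (lambda_min A)\<^sup>2)"
    and "1 + \<beta> * (lambda_max A / (lambda_min A)\<^sup>2) \<le> 1 + (cond_number A)\<^sup>2"
proof -
  have c: "0 < lambda_min A" using lambda_min_pos[OF pd n_pos] .
  have "lambda_min A \<le> lambda_max A" using lambda_min_le[OF n_pos] lambda_max_ge[OF n_pos] by simp
  hence "1 / lambda_min A \<le> lambda_max A / (lambda_min A)\<^sup>2"
    using c by (simp add: field_simps power2_eq_square)
  from mult_left_mono[OF this \<beta>(1)] show "1 + \<beta> / lambda_min A \<le> 1 + \<beta> * (lambda_max A / (lambda_min A)\<^sup>2)"
    by simp
  have "\<beta> * (lambda_max A / (lambda_min A)\<^sup>2) \<le> lambda_max A * (lambda_max A / (lambda_min A)\<^sup>2)"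
    using \<beta> by (intro mult_right_mono) auto
  thus "1 + \<beta> * (lambda_max A / (lambda_min A)\<^sup>2) \<le> 1 + (cond_number A)\<^sup>2"
    by (simp add: cond_number_def power_divide power2_eq_square)
qed

end

section \<open>Near instance optimality\<close>

theorem theorem4p1:
  fixes A :: "complex mat" and b :: "complex vec" and f g :: "real \<Rightarrow> real" and n m :: nat
  assumes "A \<in> carrier_mat n n" and "hermitian_pos_def A"
    and "b \<in> carrier_vec n" and "vec_norm b = 1"
    and "stieltjes_function g" and "\<And>z. 0 < z \<Longrightarrow> f z = z * g z"
    and "1 \<le> m" and "m \<le> invariance_index A b"
  defines "err \<equiv> \<lambda>p. vec_norm (mat_fun f A *\<^sub>v b - mat_poly p A *\<^sub>v b)"
  shows "\<exists>q. is_arg_min err (\<lambda>p. degree p \<le> m - 1) q \<and>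
    vec_norm (mat_fun f A *\<^sub>v b - lanczos_approx f A b m)
      \<le> (1 + lanczos_beta A b (m + 1) * (lambda_max A / (lambda_min A)\<^sup>2)) * err q \<and>
    (1 + lanczos_beta A b (m + 1) * (lambda_max A / (lambda_min A)\<^sup>2)) * err q
      \<le> (1 + (cond_number A)\<^sup>2) * err q"
proof -
  note pd = assms(2)
  have "mat_adjoint A = A" using pd by (simp add: hermitian_pos_def_def)
  with assms(1) obtain U d where "unitary_diag n U d A" using hermitian_unitary_diag by blast
  then interpret lanczos_diagonalization n U d A b
    using assms(3,4) by unfold_locales
  obtain W \<theta> where ritz: "lanczos_ritz n m d cv \<alpha> (lanczos_beta A b) W \<theta>"
    and approx_carrier: "\<And>f. lanczos_approx f A b m \<in> carrier_vec n"
    and approx: "\<And>f i. co (lanczos_approx f A b m) i =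
       (\<Sum>k<m. f (\<theta> k) * cnj (W 0 k) * (\<Sum>p<m. W p k * cv (Suc p) i))"
    using lanczos_ritz_exists[OF assms(7,8)] by blast
  obtain N :: "real measure" where N: "space N \<subseteq> {0..}" "(\<lambda>t. t) \<in> borel_measurable N"
    "integrable N (\<lambda>t. 1 / (1 + t))" and g: "\<And>z. 0 < z \<Longrightarrow> g z = (\<integral>t. 1 / (z + t) \<partial>N)"
    using stieltjes_function_as_integral[OF assms(5)] by blast
  let ?\<beta> = "lanczos_beta A b (Suc m)"
  have \<beta>: "0 \<le> ?\<beta>" using lanczos_beta_nonneg[of "m - 1"] assms(7) by simp
  interpret lanczos_ritz n m d cv \<alpha> "lanczos_beta A b" W \<theta> by (rule ritz)
  interpret stieltjes_lanczos n m d cv \<alpha> "lanczos_beta A b" W \<theta> N f "lambda_min A"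
    by unfold_locales (use N g assms(6) \<beta> lambda_min_le lambda_min_pos[OF pd n_pos] in auto)
  have "0 \<le> lambda_max A" using d_pos[OF pd n_pos] lambda_max_ge[OF n_pos] by simp
  hence \<beta>_le: "?\<beta> \<le> lambda_max A"
    using beta_le[of "lambda_max A"] d_pos[OF pd] lambda_max_ge by (simp add: abs_of_pos)
  have carr: "mat_fun f A *\<^sub>v b \<in> carrier_vec n" "mat_poly p A *\<^sub>v b \<in> carrier_vec n"
    "lanczos_approx f A b m \<in> carrier_vec n" for p
    using b by (auto intro!: approx_carrier mult_mat_vec_carrier[of _ n n] mat_fun_carrier mat_poly_carrier)
  have err: "err p = nrm n (\<lambda>i. f (d i) * cv 1 i - poly p (complex_of_real (d i)) * cv 1 i)" for p
  proof -
    have "err p = nrm n (co (mat_fun f A *\<^sub>v b - mat_poly p A *\<^sub>v b))"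
      unfolding err_def using carr(1,2) by (simp add: vec_norm_co)
    also have "\<dots> = nrm n (\<lambda>i. f (d i) * cv 1 i - poly p (complex_of_real (d i)) * cv 1 i)"
      unfolding nrm_def using carr(1,2) b by (intro L2_set_cong) (simp_all add: co_diff co_mat_fun co_mat_poly)
    finally show ?thesis .
  qed
  have lanczos_err: "vec_norm (mat_fun f A *\<^sub>v b - lanczos_approx f A b m) = nrm n E"
  proof -
    have "vec_norm (mat_fun f A *\<^sub>v b - lanczos_approx f A b m) =
        nrm n (co (mat_fun f A *\<^sub>v b - lanczos_approx f A b m))"
      using carr(1,3) by (simp add: vec_norm_co)
    also have "\<dots> = nrm n E"
      unfolding nrm_def using carr(1,3) b
      by (intro L2_set_cong) (simp_all add: co_diff co_mat_fun approx E_def y_def)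
    finally show ?thesis .
  qed
  obtain q where q: "degree q \<le> m - 1" "\<And>p. degree p \<le> m - 1 \<Longrightarrow> err q \<le> err p"
    "nrm n E \<le> (1 + ?\<beta> / lambda_min A) * err q"
    using near_optimal unfolding err by blast
  have err_nonneg: "0 \<le> err q" by (simp add: err)
  note const = near_optimal_constant_mono[OF pd \<beta> \<beta>_le]
  show ?thesis
  proof (intro exI[of _ q] conjI)
    show "is_arg_min err (\<lambda>p. degree p \<le> m - 1) q"
      unfolding is_arg_min_def using q(1,2) by (auto simp: not_less)
    show "vec_norm (mat_fun f A *\<^sub>v b - lanczos_approx f A b m)
      \<le> (1 + lanczos_beta A b (m + 1) * (lambda_max A / (lambda_min A)\<^sup>2)) * err q"
      unfolding lanczos_err Suc_eq_plus1[symmetric]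
      using q(3) mult_right_mono[OF const(1) err_nonneg] by (rule order_trans)
    show "(1 + lanczos_beta A b (m + 1) * (lambda_max A / (lambda_min A)\<^sup>2)) * err q
      \<le> (1 + (cond_number A)\<^sup>2) * err q"
      unfolding Suc_eq_plus1[symmetric] by (rule mult_right_mono[OF const(2) err_nonneg])
  qed
qed

end
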